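(* Let $p,q,n$ be positive integers, let $X$ in $\mathbb R^p$ and $Y$ in $\mathbb R^q$ be random vectors, and let $(\mathbf X,\mathbf Y)=\{(X_k,Y_k):k=1,\dots,n\}$ be a random sample from the joint distribution of $(X,Y)$, where $\mathbf X$ (resp. $\mathbf Y$) is regarded as the $n\times p$ (resp. $n\times q$) matrix whose rows are the sample vectors $X_k$ (resp. $Y_k$). (i) If $E(|X|_p+|Y|_q)<\infty$, then $0\le\mathcal R(X,Y)\le 1$, and $\mathcal R(X,Y)=0$ if and only if $X$ and $Y$ are independent. (ii) $0\le\mathcal R_n(\mathbf X,\mathbf Y)\le 1$. (iii) If $\mathcal R_n(\mathbf X,\mathbf Y)=1$, then there exist a vector $a$, a nonzero real number $b$ and an orthogonal matrix $C$ such that $\mathbf Y=a+b\mathbf XC$.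
   Context: $|\cdot|_d$ is the Euclidean norm on $\mathbb R^d$. $f_X,f_Y,f_{X,Y}$ denote the characteristic functions of $X$, $Y$ and the joint characteristic function, $f_{X,Y}(t,s)=E e^{i\langle t,X\rangle+i\langle s,Y\rangle}$. Distance covariance: for $X,Y$ with finite first moments, $\mathcal V(X,Y)\ge 0$ is defined by $$\mathcal V^2(X,Y)=\frac1{c_pc_q}\int_{\mathbb R^{p+q}}\frac{|f_{X,Y}(t,s)-f_X(t)f_Y(s)|^2}{|t|_p^{1+p}|s|_q^{1+q}}\,dt\,ds,\qquad c_d=\frac{\pi^{(1+d)/2}}{\Gamma((1+d)/2)},$$ and $\mathcal V^2(X)=\mathcal V^2(X,X)$, where $f_{X,X}(t,s)=f_X(t+s)$; similarly $\mathcal V^2(Y)=\mathcal V^2(Y,Y)$. Distance correlation: $\mathcal R(X,Y)\ge0$ is defined by $\mathcal R^2(X,Y)=\mathcal V^2(X,Y)/\sqrt{\mathcal V^2(X)\mathcal V^2(Y)}$ if $\mathcal V^2(X)\mathcal V^2(Y)>0$, and $\mathcal R^2(X,Y)=0$ if $\mathcal V^2(X)\mathcal V^2(Y)=0$. Empirical versions: put $a_{kl}=|X_k-X_l|_p$, $\bar a_{k\cdot}=\frac1n\sum_{l=1}^n a_{kl}$, $\bar a_{\cdot l}=\frac1n\sum_{k=1}^n a_{kl}$, $\bar a_{\cdot\cdot}=\frac1{n^2}\sum_{k,l=1}^n a_{kl}$, $A_{kl}=a_{kl}-\bar a_{k\cdot}-\bar a_{\cdot l}+\bar a_{\cdot\cdot}$;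 similarly $b_{kl}=|Y_k-Y_l|_q$ and $B_{kl}=b_{kl}-\bar b_{k\cdot}-\bar b_{\cdot l}+\bar b_{\cdot\cdot}$. Then $\mathcal V_n^2(\mathbf X,\mathbf Y)=\frac1{n^2}\sum_{k,l=1}^n A_{kl}B_{kl}$ (which is always nonnegative), $\mathcal V_n^2(\mathbf X)=\frac1{n^2}\sum_{k,l=1}^n A_{kl}^2$, $\mathcal V_n^2(\mathbf Y)=\frac1{n^2}\sum_{k,l=1}^n B_{kl}^2$, and $\mathcal R_n(\mathbf X,\mathbf Y)$ is the nonnegative square root of $\mathcal R_n^2(\mathbf X,\mathbf Y)=\mathcal V_n^2(\mathbf X,\mathbf Y)/\sqrt{\mathcal V_n^2(\mathbf X)\mathcal V_n^2(\mathbf Y)}$ if $\mathcal V_n^2(\mathbf X)\mathcal V_n^2(\mathbf Y)>0$, and $\mathcal R_n^2(\mathbf X,\mathbf Y)=0$ if $\mathcal V_n^2(\mathbf X)\mathcal V_n^2(\mathbf Y)=0$. In $\mathbf Y=a+b\mathbf XC$ the vector $a$ is added to each row of $b\mathbf XC$. *)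

theory Defs
  imports "HOL-Probability.Probability"
begin

section \<open>Independence of two random vectors\<close>

text \<open>
  \<^const>\<open>prob_space.indep_var\<close> requires both random variables to have the same type, which
  excludes vectors of different dimensions.
\<close>

definition indep_rvec ::
  "'w measure \<Rightarrow> ('w \<Rightarrow> 'a::euclidean_space) \<Rightarrow> ('w \<Rightarrow> 'b::euclidean_space) \<Rightarrow> bool" where
  "indep_rvec M X Y \<longleftrightarrow>
     prob_space.indep_set M
       {X -` A \<inter> space M | A. A \<in> sets borel} {Y -` B \<inter> space M | B. B \<in> sets borel}"

lemma indep_rvec_eq_indep_var:
  fixes X Y :: "'w \<Rightarrow> 'a::euclidean_space"
  assumes "prob_space M" and "X \<in> borel_measurable M" and "Y \<in> borel_measurable M"
  shows "indep_rvec M X Y \<longleftrightarrow> prob_space.indep_var M borel X borel Y"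
proof -
  interpret prob_space M by fact
  have sig: "sigma_sets (space M) {Z -` A \<inter> space M | A. A \<in> sets borel}
      = {Z -` A \<inter> space M | A. A \<in> sets borel}" for Z :: "'w \<Rightarrow> 'a"
    using sets_vimage_algebra[of "space M" Z borel] sets_vimage_algebra2[of Z "space M" borel]
    by simp
  show ?thesis
    unfolding indep_rvec_def indep_var_eq sig using assms by simp
qed


section \<open>Population distance covariance and distance correlation\<close>

definition char_fun :: "'w measure \<Rightarrow> ('w \<Rightarrow> 'a::euclidean_space) \<Rightarrow> 'a \<Rightarrow> complex" where
  "char_fun M X t = (\<integral>w. exp (\<i> * complex_of_real (t \<bullet> X w)) \<partial>M)"

definition joint_char_fun ::
  "'w measure \<Rightarrow> ('w \<Rightarrow> 'a::euclidean_space) \<Rightarrow> ('w \<Rightarrow> 'b::euclidean_space) \<Rightarrow> 'a \<Rightarrow> 'b \<Rightarrow> complex" where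
  "joint_char_fun M X Y t s =
     (\<integral>w. exp (\<i> * complex_of_real (t \<bullet> X w) + \<i> * complex_of_real (s \<bullet> Y w)) \<partial>M)"

definition dcov_const :: "nat \<Rightarrow> real" where
  "dcov_const d = pi powr ((1 + real d) / 2) / Gamma ((1 + real d) / 2)"

text \<open>
  The squared distance covariance. The integrand is set to 0 by division by zero on the null set
  where \<^term>\<open>t = 0\<close> or \<^term>\<open>s = 0\<close>. The definition is meaningful
  only for random vectors with finite first moments; otherwise the integral may have the default
  value 0.
\<close>

definition dcov2 ::
  "'w measure \<Rightarrow> ('w \<Rightarrow> 'a::euclidean_space) \<Rightarrow> ('w \<Rightarrow> 'b::euclidean_space) \<Rightarrow> real" where
  "dcov2 M X Y =
     1 / (dcov_const DIM('a) * dcov_const DIM('b)) *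
     (\<integral>(t, s). (cmod (joint_char_fun M X Y t s - char_fun M X t * char_fun M Y s))\<^sup>2 /
               (norm t ^ (1 + DIM('a)) * norm s ^ (1 + DIM('b))) \<partial>lborel)"

definition dvar2 :: "'w measure \<Rightarrow> ('w \<Rightarrow> 'a::euclidean_space) \<Rightarrow> real" where
  "dvar2 M X = dcov2 M X X"

definition dcor2 ::
  "'w measure \<Rightarrow> ('w \<Rightarrow> 'a::euclidean_space) \<Rightarrow> ('w \<Rightarrow> 'b::euclidean_space) \<Rightarrow> real" where
  "dcor2 M X Y =
     (if dvar2 M X * dvar2 M Y > 0 then dcov2 M X Y / sqrt (dvar2 M X * dvar2 M Y) else 0)"

definition dcor ::
  "'w measure \<Rightarrow> ('w \<Rightarrow> 'a::euclidean_space) \<Rightarrow> ('w \<Rightarrow> 'b::euclidean_space) \<Rightarrow> real" where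
  "dcor M X Y = sqrt (dcor2 M X Y)"


section \<open>Empirical versions\<close>

text \<open>A sample of size \<open>CARD('n)\<close> is a matrix whose rows are the sample vectors.\<close>

definition sample_matrix :: "('n::finite \<Rightarrow> 'w \<Rightarrow> real^'p) \<Rightarrow> 'w \<Rightarrow> real^'p^'n" where
  "sample_matrix X w = (\<chi> k. X k w)"

definition pair_dist :: "real^'p^'n \<Rightarrow> 'n \<Rightarrow> 'n \<Rightarrow> real" where
  "pair_dist X k l = norm (X $ k - X $ l)"

definition double_centered :: "('n::finite \<Rightarrow> 'n \<Rightarrow> real) \<Rightarrow> 'n \<Rightarrow> 'n \<Rightarrow> real" where
  "double_centered a k l =
     a k l
     - 1 / real CARD('n) * (\<Sum>j\<in>UNIV. a k j)
     - 1 / real CARD('n) * (\<Sum>i\<in>UNIV. a i l)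
     + 1 / (real CARD('n))\<^sup>2 * (\<Sum>i\<in>UNIV. \<Sum>j\<in>UNIV. a i j)"

definition emp_dcov2 :: "real^'p^'n \<Rightarrow> real^'q^'n \<Rightarrow> real" where
  "emp_dcov2 X Y =
     1 / (real CARD('n))\<^sup>2 *
     (\<Sum>k\<in>UNIV. \<Sum>l\<in>UNIV.
        double_centered (pair_dist X) k l * double_centered (pair_dist Y) k l)"

definition emp_dvar2 :: "real^'p^'n \<Rightarrow> real" where
  "emp_dvar2 X =
     1 / (real CARD('n))\<^sup>2 *
     (\<Sum>k\<in>UNIV. \<Sum>l\<in>UNIV. (double_centered (pair_dist X) k l)\<^sup>2)"

definition emp_dcor2 :: "real^'p^'n \<Rightarrow> real^'q^'n \<Rightarrow> real" where
  "emp_dcor2 X Y =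
     (if emp_dvar2 X * emp_dvar2 Y > 0
      then emp_dcov2 X Y / sqrt (emp_dvar2 X * emp_dvar2 Y) else 0)"

definition emp_dcor :: "real^'p^'n \<Rightarrow> real^'q^'n \<Rightarrow> real" where
  "emp_dcor X Y = sqrt (emp_dcor2 X Y)"


section \<open>Orthogonality of rectangular matrices\<close>

text \<open>
  In \<open>Y = a + b X C\<close> the matrix \<open>C\<close> has \<open>p\<close> rows and \<open>q\<close> columns, so for \<open>p \<noteq> q\<close>
  orthogonality has to be read as: the rows of \<open>C\<close> are orthonormal (possible only for \<open>p \<le> q\<close>),
  or its columns are (possible only for \<open>q \<le> p\<close>). For square matrices this is the usual notion.
\<close>

definition orthogonal_rect :: "real^'q^'p \<Rightarrow> bool" where
  "orthogonal_rect C \<longleftrightarrow> C ** transpose C = mat 1 \<or> transpose C ** C = mat 1"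

lemma orthogonal_rect_square:
  fixes C :: "real^'n^'n"
  shows "orthogonal_rect C \<longleftrightarrow> orthogonal_matrix C"
  unfolding orthogonal_rect_def orthogonal_matrix_def
  by (metis matrix_left_right_inverse)

end

theory Submission
  imports Defs
begin

text \<open>
  Population part. Put \<open>U t = exp (i (t \<bullet> X)) - f\<^sub>X t\<close> and \<open>V s = exp (i (s \<bullet> Y)) - f\<^sub>Y s\<close>, so that
  \<open>f\<^sub>X\<^sub>Y - f\<^sub>X f\<^sub>Y = E (U t V s)\<close>. A finite first moment makes \<open>U\<close> square integrable for the weight
  \<open>1 / norm t ^ (1 + p)\<close>, because \<open>E \<bar>U t\<bar>\<^sup>2 \<le> 2 E (1 - cos (t \<bullet> X))\<close> and the weighted integral of
  \<open>1 - cos (t \<bullet> x)\<close> is at most a multiple of \<open>norm x\<close>. Hence the distance covariance is a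
  convergent integral. It vanishes iff the continuous function \<open>f\<^sub>X\<^sub>Y - f\<^sub>X f\<^sub>Y\<close> does, and by
  uniqueness of characteristic functions that is independence. If a distance variance is \<open>0\<close>, the
  same equivalence shows that the vector is independent of itself; all its events then have
  probability \<open>0\<close> or \<open>1\<close>, so it is independent of everything, in agreement with the convention
  that the correlation is \<open>0\<close>.

  For the upper bound, write \<open>\<bar>E (U t V s)\<bar>\<^sup>2\<close> as an expectation over two independent copies and
  integrate over \<open>t\<close> and \<open>s\<close> first: the squared distance covariance becomes \<open>E (K L)\<close>, where \<open>K\<close> and
  \<open>L\<close> are kernels on pairs of sample points built from \<open>U\<close> and \<open>V\<close> alone. The Cauchy-Schwarz
  inequality for \<open>K\<close> and \<open>L\<close> is the claim, since \<open>E \<bar>K\<bar>\<^sup>2\<close> and \<open>E \<bar>L\<bar>\<^sup>2\<close> are the distance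
  variances, up to the normalizing constants.

  Sample part. The matrices \<open>A\<close> and \<open>B\<close> of double centered distances are negative semidefinite, and
  \<open>\<Sum> A B = \<Sum> a B\<close> is nonnegative. Both facts are instances of one inequality: if \<open>P\<close> is positive
  semidefinite with total sum \<open>0\<close>, then \<open>\<Sum> P k l * norm (x k - x l) \<le> 0\<close>. It holds because the
  distance is, up to a positive factor, the integral of
  \<open>(1 - exp (- (r * norm (x k - x l))\<^sup>2)) / r\<^sup>2\<close> over \<open>r\<close>, and Gaussian kernels are positive
  semidefinite. The bound by \<open>1\<close> is the Cauchy-Schwarz inequality. In the case of equality \<open>A\<close> and
  \<open>B\<close> are proportional with a positive factor; double centering is injective on symmetric matrices
  with zero diagonal, so the distance matrices are proportional as well. Point sets with equal
  distance matrices have equal Gram matrices after a translation, and a linear isometry between their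
  spans extends from the space of smaller dimension into the larger one.
\<close>

section \<open>Positive semidefinite kernels and Euclidean distances\<close>

definition psd :: "('n::finite \<Rightarrow> 'n \<Rightarrow> real) \<Rightarrow> bool" where
  "psd P \<longleftrightarrow> (\<forall>c. 0 \<le> (\<Sum>k\<in>UNIV. \<Sum>l\<in>UNIV. c k * c l * P k l))"

text \<open>
  A special case of the Schur product theorem: expand the inner product in the basis and absorb the
  coordinates of the points into the coefficients of the quadratic form.
\<close>
lemma psd_mult_inner:
  fixes x :: "'n::finite \<Rightarrow> 'a::euclidean_space"
  assumes "psd P"
  shows "psd (\<lambda>k l. P k l * (x k \<bullet> x l))"
  unfolding psd_def
proof
  fix c
  have "(\<Sum>k\<in>UNIV. \<Sum>l\<in>UNIV. c k * c l * (P k l * (x k \<bullet> x l)))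
      = (\<Sum>k\<in>UNIV. \<Sum>l\<in>UNIV. \<Sum>b\<in>Basis. (c k * (x k \<bullet> b)) * (c l * (x l \<bullet> b)) * P k l)"
    by (subst euclidean_inner) (simp add: sum_distrib_left mult_ac)
  also have "\<dots> = (\<Sum>k\<in>UNIV. \<Sum>b\<in>Basis. \<Sum>l\<in>UNIV. (c k * (x k \<bullet> b)) * (c l * (x l \<bullet> b)) * P k l)"
    by (intro sum.cong refl sum.swap)
  also have "\<dots> = (\<Sum>b\<in>Basis. \<Sum>k\<in>UNIV. \<Sum>l\<in>UNIV. (c k * (x k \<bullet> b)) * (c l * (x l \<bullet> b)) * P k l)"
    by (rule sum.swap)
  also have "\<dots> \<ge> 0"
  proof (rule sum_nonneg)
    fix b :: 'a
    show "0 \<le> (\<Sum>k\<in>UNIV. \<Sum>l\<in>UNIV. (c k * (x k \<bullet> b)) * (c l * (x l \<bullet> b)) * P k l)"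
      using assms[unfolded psd_def, THEN spec, of "\<lambda>k. c k * (x k \<bullet> b)"] .
  qed
  finally show "0 \<le> (\<Sum>k\<in>UNIV. \<Sum>l\<in>UNIV. c k * c l * (P k l * (x k \<bullet> x l)))" .
qed

lemma psd_mult_inner_power:
  fixes x :: "'n::finite \<Rightarrow> 'a::euclidean_space"
  assumes "psd P"
  shows "psd (\<lambda>k l. P k l * (x k \<bullet> x l) ^ m)"
proof (induction m)
  case (Suc m)
  show ?case using psd_mult_inner[OF Suc, of x] by (simp add: mult_ac)
qed (use assms in simp)

text \<open>
  Since \<open>exp (- (norm (x - y))\<^sup>2) = exp (- (x \<bullet> x)) * exp (- (y \<bullet> y)) * exp (2 * (x \<bullet> y))\<close>, the first
  two factors can be absorbed into the coefficients, and the exponential series turns the last one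
  into a combination of powers of inner products with nonnegative weights.
\<close>
lemma psd_mult_gaussian:
  fixes x :: "'n::finite \<Rightarrow> 'a::euclidean_space"
  assumes "psd P"
  shows "psd (\<lambda>k l. P k l * exp (- (norm (x k - x l))\<^sup>2))"
  unfolding psd_def
proof
  fix c
  define d where "d k = c k * exp (- (x k \<bullet> x k))" for k
  have eq: "c k * c l * (P k l * exp (- (norm (x k - x l))\<^sup>2))
      = d k * d l * P k l * exp (2 * (x k \<bullet> x l))" for k l
  proof -
    have "- (norm (x k - x l))\<^sup>2 = - (x k \<bullet> x k) + - (x l \<bullet> x l) + 2 * (x k \<bullet> x l)"
      by (simp add: power2_norm_eq_inner inner_diff_left inner_diff_right inner_commute)
    then have "exp (- (norm (x k - x l))\<^sup>2)
        = exp (- (x k \<bullet> x k)) * exp (- (x l \<bullet> x l)) * exp (2 * (x k \<bullet> x l))"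
      by (simp only: exp_add)
    then show ?thesis by (simp add: d_def mult_ac)
  qed
  have S: "(\<lambda>m. \<Sum>k\<in>UNIV. \<Sum>l\<in>UNIV. d k * d l * P k l * ((2 * (x k \<bullet> x l)) ^ m /\<^sub>R fact m))
      sums (\<Sum>k\<in>UNIV. \<Sum>l\<in>UNIV. d k * d l * P k l * exp (2 * (x k \<bullet> x l)))"
    by (intro sums_sum sums_mult exp_converges)
  have nonneg: "(0::real) \<le> (\<Sum>k\<in>UNIV. \<Sum>l\<in>UNIV. d k * d l * P k l * ((2 * (x k \<bullet> x l)) ^ m /\<^sub>R fact m))"
    for m
  proof -
    have "(\<Sum>k\<in>UNIV. \<Sum>l\<in>UNIV. d k * d l * P k l * ((2 * (x k \<bullet> x l)) ^ m /\<^sub>R fact m))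
       = 2 ^ m / fact m * (\<Sum>k\<in>UNIV. \<Sum>l\<in>UNIV. d k * d l * (P k l * (x k \<bullet> x l) ^ m))"
      by (simp add: sum_distrib_left power_mult_distrib divide_inverse mult_ac)
    also have "\<dots> \<ge> 0"
      using psd_mult_inner_power[OF assms, of x m] unfolding psd_def by (intro mult_nonneg_nonneg) auto
    finally show ?thesis .
  qed
  have "0 \<le> (\<Sum>k\<in>UNIV. \<Sum>l\<in>UNIV. d k * d l * P k l * exp (2 * (x k \<bullet> x l)))"
    using nonneg by (rule sums_le[OF _ sums_zero S])
  then show "0 \<le> (\<Sum>k\<in>UNIV. \<Sum>l\<in>UNIV. c k * c l * (P k l * exp (- (norm (x k - x l))\<^sup>2)))"
    by (simp add: eq)
qed

lemma integrable_inverse_one_plus_square: "integrable lborel (\<lambda>x::real. inverse (1 + x\<^sup>2))"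
  using integrable_inverse_1_plus_square
  by (simp add: set_integrable_def einterval_def)

lemma integrable_one_minus_gaussian:
  "integrable lborel (\<lambda>r::real. (1 - exp (- r\<^sup>2)) / r\<^sup>2)"
proof (rule Bochner_Integration.integrable_bound)
  show "integrable lborel (\<lambda>x::real. 2 * inverse (1 + x\<^sup>2))"
    using integrable_inverse_one_plus_square by simp
  have "(1 - exp (- r\<^sup>2)) / r\<^sup>2 \<le> 2 * inverse (1 + r\<^sup>2)" if "r \<noteq> 0" for r :: real
  proof -
    have r: "r\<^sup>2 > 0" using that by simp
    have "1 - exp (- r\<^sup>2) \<le> r\<^sup>2" "1 - exp (- r\<^sup>2) \<le> 1"
      using exp_ge_add_one_self[of "- r\<^sup>2"] by auto
    moreover from this have "(1 - exp (- r\<^sup>2)) * r\<^sup>2 \<le> 1 * r\<^sup>2"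
      by (intro mult_right_mono) auto
    ultimately have "(1 - exp (- r\<^sup>2)) * (1 + r\<^sup>2) \<le> 2 * r\<^sup>2"
      unfolding distrib_left mult_1_right mult_1_left mult_2 by linarith
    then have "(1 - exp (- r\<^sup>2)) * (1 + r\<^sup>2) * inverse (1 + r\<^sup>2) / r\<^sup>2
        \<le> 2 * r\<^sup>2 * inverse (1 + r\<^sup>2) / r\<^sup>2"
      by (intro divide_right_mono mult_right_mono) auto
    moreover have "(1 + r\<^sup>2) * inverse (1 + r\<^sup>2) = 1" using r by (intro right_inverse) linarith
    ultimately show ?thesis using r by (simp add: mult.assoc)
  qed
  then have "norm ((1 - exp (- r\<^sup>2)) / r\<^sup>2) \<le> norm (2 * inverse (1 + r\<^sup>2))" for r :: real
    by (cases "r = 0") auto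
  then show "AE r in lborel. norm ((1 - exp (- r\<^sup>2)) / r\<^sup>2) \<le> norm (2 * inverse (1 + (r::real)\<^sup>2))"
    by simp
qed simp

text \<open>
  The substitution \<open>r \<mapsto> r / z\<close> pulls out exactly one factor \<open>z\<close>. This gives the distance as an
  integral over a real variable, whatever the dimension of the points is.
\<close>
lemma distance_as_gaussian_mixture:
  fixes z :: real
  assumes "z \<ge> 0"
  shows "integrable lborel (\<lambda>r. (1 - exp (- (r * z)\<^sup>2)) / r\<^sup>2)"
    and "(\<integral>r. (1 - exp (- (r * z)\<^sup>2)) / r\<^sup>2 \<partial>lborel) = z * (\<integral>r. (1 - exp (- r\<^sup>2)) / r\<^sup>2 \<partial>lborel)"
proof -
  let ?g = "\<lambda>r::real. (1 - exp (- r\<^sup>2)) / r\<^sup>2"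
  have eq: "(1 - exp (- (r * z)\<^sup>2)) / r\<^sup>2 = z\<^sup>2 * ?g (0 + z * r)" for r
    by (cases "z = 0") (auto simp: power_mult_distrib mult_ac)
  show "integrable lborel (\<lambda>r. (1 - exp (- (r * z)\<^sup>2)) / r\<^sup>2)"
    unfolding eq
    using lborel_integrable_real_affine[OF integrable_one_minus_gaussian, of z 0]
    by (cases "z = 0") (auto simp del: times_divide_eq_right)
  show "(\<integral>r. (1 - exp (- (r * z)\<^sup>2)) / r\<^sup>2 \<partial>lborel) = z * (\<integral>r. ?g r \<partial>lborel)"
  proof (cases "z = 0")
    case False
    have "(\<integral>r. ?g r \<partial>lborel) = z * (\<integral>r. ?g (0 + z * r) \<partial>lborel)"
      using lborel_integral_real_affine[OF False, of ?g 0] assms by simp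
    then show ?thesis
      unfolding eq by (simp add: power2_eq_square[of z] del: times_divide_eq_right)
  qed simp
qed

lemma integral_one_minus_gaussian_pos: "0 < (\<integral>r. (1 - exp (- (r::real)\<^sup>2)) / r\<^sup>2 \<partial>lborel)"
proof -
  let ?g = "\<lambda>r::real. (1 - exp (- r\<^sup>2)) / r\<^sup>2"
  have nn: "0 \<le> ?g r" for r by simp
  have "(\<integral>r. ?g r \<partial>lborel) \<noteq> 0"
  proof
    assume "(\<integral>r. ?g r \<partial>lborel) = 0"
    then have "AE r in lborel. ?g r = 0"
      using integral_nonneg_eq_0_iff_AE[OF integrable_one_minus_gaussian] nn by simp
    then have "AE r in lborel. (r::real) \<in> {0}"
      by eventually_elim (auto split: if_splits)
    then have "emeasure lborel (- {0::real}) = 0"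
      by (subst (asm) AE_iff_measurable[of "- {0}"]) auto
    moreover have "emeasure lborel {1..2::real} \<le> emeasure lborel (- {0::real})"
      by (intro emeasure_mono) auto
    ultimately show False by simp
  qed
  moreover have "(\<integral>r. ?g r \<partial>lborel) \<ge> 0" by (rule Bochner_Integration.integral_nonneg) (rule nn)
  ultimately show ?thesis by linarith
qed

text \<open>
  Under the integral of the Gaussian mixture the constant \<open>1\<close> contributes nothing, because \<open>P\<close> has
  total sum \<open>0\<close>; what remains is minus the sum of the entries of a positive semidefinite kernel.
\<close>
lemma psd_sum_distance_nonpos:
  fixes x :: "'n::finite \<Rightarrow> 'a::euclidean_space"
  assumes psd: "psd P" and total: "(\<Sum>k\<in>UNIV. \<Sum>l\<in>UNIV. P k l) = 0"
  shows "(\<Sum>k\<in>UNIV. \<Sum>l\<in>UNIV. P k l * norm (x k - x l)) \<le> 0"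
proof -
  let ?\<kappa> = "\<integral>r. (1 - exp (- (r::real)\<^sup>2)) / r\<^sup>2 \<partial>lborel"
  define h where "h r k l = (1 - exp (- (r * norm (x k - x l))\<^sup>2)) / r\<^sup>2" for r k l
  have "(\<Sum>k\<in>UNIV. \<Sum>l\<in>UNIV. P k l * norm (x k - x l)) * ?\<kappa>
      = (\<Sum>k\<in>UNIV. \<Sum>l\<in>UNIV. P k l * (\<integral>r. h r k l \<partial>lborel))"
    by (simp add: distance_as_gaussian_mixture(2) h_def sum_distrib_right mult_ac)
  also have "\<dots> = - (\<integral>r. - (\<Sum>k\<in>UNIV. \<Sum>l\<in>UNIV. P k l * h r k l) \<partial>lborel)"
  proof -
    have "integrable lborel (\<lambda>r. P k l * h r k l)" for k l
      unfolding h_def by (intro integrable_mult_right distance_as_gaussian_mixture(1)) simp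
    then show ?thesis
      by (simp add: Bochner_Integration.integral_sum del: times_divide_eq_right)
  qed
  also have "\<dots> \<le> 0"
    unfolding neg_le_0_iff_le
  proof (rule Bochner_Integration.integral_nonneg)
    fix r :: real
    let ?e = "\<lambda>k l. exp (- (norm (r *\<^sub>R x k - r *\<^sub>R x l))\<^sup>2)"
    have e: "?e k l = exp (- (r * norm (x k - x l))\<^sup>2)" for k l
      by (simp add: power_mult_distrib flip: scaleR_diff_right)
    have "(\<Sum>k\<in>UNIV. \<Sum>l\<in>UNIV. P k l * h r k l)
        = ((\<Sum>k\<in>UNIV. \<Sum>l\<in>UNIV. P k l) - (\<Sum>k\<in>UNIV. \<Sum>l\<in>UNIV. P k l * ?e k l)) / r\<^sup>2"
      unfolding e h_def
      by (simp add: right_diff_distrib sum_subtractf flip: sum_divide_distrib)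
    also have "\<dots> \<le> 0"
    proof -
      have "0 \<le> (\<Sum>k\<in>UNIV. \<Sum>l\<in>UNIV. 1 * 1 * (P k l * ?e k l))"
        using psd_mult_gaussian[OF psd, of "\<lambda>k. r *\<^sub>R x k", unfolded psd_def, THEN spec,
            of "\<lambda>_. 1"] .
      then show ?thesis using total by (simp add: divide_nonpos_nonneg)
    qed
    finally show "0 \<le> - (\<Sum>k\<in>UNIV. \<Sum>l\<in>UNIV. P k l * h r k l)" by simp
  qed
  finally show ?thesis
    using integral_one_minus_gaussian_pos by (simp add: mult_le_0_iff)
qed

section \<open>Double centering and the sample distance covariance\<close>

lemma double_centered_row_sum:
  fixes a :: "'n::finite \<Rightarrow> 'n \<Rightarrow> real"
  shows "(\<Sum>l\<in>UNIV. double_centered a k l) = 0"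
proof -
  have "(\<Sum>l\<in>UNIV. \<Sum>i\<in>UNIV. a i l) = (\<Sum>i\<in>UNIV. \<Sum>l\<in>UNIV. a i l)" by (rule sum.swap)
  then show ?thesis
    by (simp add: double_centered_def sum.distrib sum_subtractf power2_eq_square
        flip: sum_divide_distrib sum_distrib_left)
qed

lemma double_centered_col_sum:
  fixes a :: "'n::finite \<Rightarrow> 'n \<Rightarrow> real"
  shows "(\<Sum>k\<in>UNIV. double_centered a k l) = 0"
  by (simp add: double_centered_def sum.distrib sum_subtractf power2_eq_square
        flip: sum_divide_distrib sum_distrib_left)

lemma double_centered_idem:
  "double_centered (double_centered a) = double_centered a"
  by (rule ext)+ (simp add: double_centered_def[of "double_centered a"] double_centered_row_sum
      double_centered_col_sum)

text \<open>
  Double centering is an orthogonal projection on matrices; with idempotence this allows centering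
  to be moved from one factor of a sum of products to the other, or dropped on one side.
\<close>
lemma double_centered_selfadjoint:
  fixes a b :: "'n::finite \<Rightarrow> 'n \<Rightarrow> real"
  shows "(\<Sum>k\<in>UNIV. \<Sum>l\<in>UNIV. double_centered a k l * b k l)
       = (\<Sum>k\<in>UNIV. \<Sum>l\<in>UNIV. a k l * double_centered b k l)"
proof -
  define N where "N = real CARD('n)"
  define T where "T c = (\<Sum>k\<in>UNIV. \<Sum>l\<in>UNIV. c k l)" for c :: "'n \<Rightarrow> 'n \<Rightarrow> real"
  define R where "R c k = (\<Sum>l\<in>UNIV. c k l)" for c :: "'n \<Rightarrow> 'n \<Rightarrow> real" and k
  define S where "S c l = (\<Sum>k\<in>UNIV. c k l)" for c :: "'n \<Rightarrow> 'n \<Rightarrow> real" and l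
  have dc: "double_centered c k l = c k l - R c k / N - S c l / N + T c / N\<^sup>2" for c k l
    by (simp add: double_centered_def N_def T_def R_def S_def)
  have *: "(\<Sum>k\<in>UNIV. \<Sum>l\<in>UNIV. double_centered a k l * b k l)
      = (\<Sum>k\<in>UNIV. \<Sum>l\<in>UNIV. a k l * b k l) - (\<Sum>k\<in>UNIV. R a k * R b k) / N
        - (\<Sum>l\<in>UNIV. S a l * S b l) / N + T a * T b / N\<^sup>2" for a b
  proof -
    have "(\<Sum>k\<in>UNIV. \<Sum>l\<in>UNIV. double_centered a k l * b k l)
      = (\<Sum>k\<in>UNIV. \<Sum>l\<in>UNIV. a k l * b k l) - (\<Sum>k\<in>UNIV. \<Sum>l\<in>UNIV. R a k * b k l) / N
        - (\<Sum>k\<in>UNIV. \<Sum>l\<in>UNIV. S a l * b k l) / N + (\<Sum>k\<in>UNIV. \<Sum>l\<in>UNIV. T a * b k l) / N\<^sup>2"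
      by (simp add: dc distrib_right left_diff_distrib sum.distrib sum_subtractf sum_divide_distrib)
    also have "(\<Sum>k\<in>UNIV. \<Sum>l\<in>UNIV. S a l * b k l) = (\<Sum>l\<in>UNIV. \<Sum>k\<in>UNIV. S a l * b k l)"
      by (rule sum.swap)
    finally show ?thesis
      by (simp add: R_def[of b] S_def[of b] T_def[of b] sum_distrib_left)
  qed
  show ?thesis
    using *[of a b] *[of b a] by (simp add: mult_ac)
qed

text \<open>
  By self-adjointness the quadratic form of the centered distances at \<open>c\<close> is the one of the distances
  themselves at the centered vector \<open>d\<close>, and \<open>d k * d l\<close> is positive semidefinite with sum \<open>0\<close>.
\<close>
lemma psd_neg_double_centered_distance:
  fixes X :: "real^'p^'n"
  shows "psd (\<lambda>k l. - double_centered (pair_dist X) k l)"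
  unfolding psd_def
proof
  fix c :: "'n \<Rightarrow> real"
  define m where "m = 1 / real CARD('n) * (\<Sum>k\<in>UNIV. c k)"
  define d where "d k = c k - m" for k
  have dc: "double_centered (\<lambda>k l. c k * c l) k l = d k * d l" for k l
  proof -
    have "(\<Sum>i\<in>UNIV. \<Sum>j\<in>UNIV. c i * c j) = (\<Sum>k\<in>UNIV. c k) * (\<Sum>k\<in>UNIV. c k)"
      by (simp add: sum_product)
    then show ?thesis
      by (simp add: double_centered_def d_def m_def power2_eq_square field_simps
          flip: sum_distrib_left sum_distrib_right)
  qed
  have d0: "(\<Sum>k\<in>UNIV. d k) = 0"
    by (simp add: d_def m_def sum_subtractf)
  have "psd (\<lambda>k l. d k * d l)"
    unfolding psd_def
  proof
    fix e :: "'n \<Rightarrow> real"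
    have "(\<Sum>k\<in>UNIV. \<Sum>l\<in>UNIV. e k * e l * (d k * d l)) = (\<Sum>k\<in>UNIV. e k * d k)\<^sup>2"
      by (simp add: power2_eq_square sum_product mult_ac)
    then show "0 \<le> (\<Sum>k\<in>UNIV. \<Sum>l\<in>UNIV. e k * e l * (d k * d l))" by simp
  qed
  moreover have "(\<Sum>k\<in>UNIV. \<Sum>l\<in>UNIV. d k * d l) = 0"
    using d0 by (simp flip: sum_distrib_left)
  ultimately have "(\<Sum>k\<in>UNIV. \<Sum>l\<in>UNIV. d k * d l * norm (X $ k - X $ l)) \<le> 0"
    by (rule psd_sum_distance_nonpos)
  moreover have "(\<Sum>k\<in>UNIV. \<Sum>l\<in>UNIV. double_centered (pair_dist X) k l * (c k * c l))
      = (\<Sum>k\<in>UNIV. \<Sum>l\<in>UNIV. d k * d l * norm (X $ k - X $ l))"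
    unfolding double_centered_selfadjoint dc by (simp add: pair_dist_def mult_ac)
  ultimately show "0 \<le> (\<Sum>k\<in>UNIV. \<Sum>l\<in>UNIV. c k * c l * - double_centered (pair_dist X) k l)"
    by (simp add: sum_negf mult_ac)
qed

text \<open>
  Here the positive semidefinite kernel is itself minus a matrix of centered distances; this takes
  the place of the Schur product theorem for two general matrices.
\<close>
lemma emp_dcov2_nonneg:
  fixes X :: "real^'p^'n" and Y :: "real^'q^'n"
  shows "0 \<le> emp_dcov2 X Y"
proof -
  let ?B = "double_centered (pair_dist Y)"
  have "(\<Sum>k\<in>UNIV. \<Sum>l\<in>UNIV. - ?B k l * norm (X $ k - X $ l)) \<le> 0"
    by (intro psd_sum_distance_nonpos psd_neg_double_centered_distance)
      (simp add: sum_negf double_centered_row_sum)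
  then have "0 \<le> (\<Sum>k\<in>UNIV. \<Sum>l\<in>UNIV. pair_dist X k l * ?B k l)"
    by (simp add: sum_negf pair_dist_def mult_ac)
  also have "\<dots> = (\<Sum>k\<in>UNIV. \<Sum>l\<in>UNIV. double_centered (pair_dist X) k l * ?B k l)"
    unfolding double_centered_selfadjoint double_centered_idem ..
  finally show ?thesis by (simp add: emp_dcov2_def)
qed

section \<open>Isometries between point sets of equal Gram matrix\<close>

text \<open>
  The map is prescribed on a basis taken from the points \<open>x i\<close>. It sends the remaining points
  correctly because \<open>g (x i) - y i\<close> lies in the span of the \<open>y j\<close> and is orthogonal to all of them.
\<close>
lemma linear_isometry_between_equal_Gram:
  fixes x :: "'i \<Rightarrow> 'a::euclidean_space" and y :: "'i \<Rightarrow> 'b::euclidean_space"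
  assumes gram: "\<And>i j. x i \<bullet> x j = y i \<bullet> y j"
  obtains g where "linear g" "\<And>i. g (x i) = y i"
    "\<And>v. v \<in> span (range x) \<Longrightarrow> norm (g v) = norm v"
proof -
  obtain B where B: "B \<subseteq> range x" "independent B" "range x \<subseteq> span B"
    by (rule basis_exists[of "range x"])
  then have B3: "span B = span (range x)"
    by (intro subset_antisym span_mono span_minimal subspace_span)
  define yy where "yy b = y (SOME i. x i = b)" for b
  obtain g where g: "linear g" "\<And>b. b \<in> B \<Longrightarrow> g b = yy b"
    using linear_independent_extend[OF B(2), of yy] by blast
  interpret linear g by (rule g(1))
  have yy: "yy (x i) = y i" for i
  proof -
    have "x (SOME j. x j = x i) = x i" by (rule someI[of _ i]) simp
    moreover have "y j = y i" if "x j = x i" for j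
    proof -
      have "(y j - y i) \<bullet> (y j - y i) = (x j - x i) \<bullet> (x j - x i)"
        by (simp add: inner_diff_left inner_diff_right gram)
      then show ?thesis using that by simp
    qed
    ultimately show ?thesis unfolding yy_def by blast
  qed
  have 1: "g v \<bullet> y j = v \<bullet> x j" if "v \<in> span B" for v j
    using that
  proof (induction rule: span_induct_alt)
    case (step c b v)
    then obtain i where "b = x i" using B(1) by auto
    then show ?case using step g(2)[of b] by (simp add: add scale inner_add_left yy gram)
  qed (simp add: zero)
  have "g b \<in> span (range y)" if "b \<in> B" for b
    using that B(1) g(2) yy by (auto simp: span_base)
  then have "g ` span B \<subseteq> span (range y)"
    unfolding span_linear_image[OF g(1), symmetric] by (intro span_minimal subspace_span) auto
  then have "g (x i) \<in> span (range y)" for i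
    unfolding B3 using span_base[of "x i" "range x"] by blast
  then have 2: "g (x i) - y i \<in> span (range y)" for i
    by (rule span_diff) (simp add: span_base)
  have 3: "g (x i) = y i" for i
  proof -
    have orth: "(g (x i) - y i) \<bullet> y j = 0" for j
      using 1[of "x i" j] by (simp add: inner_diff_left gram B3 span_base)
    have "orthogonal (g (x i) - y i) w" if "w \<in> span (range y)" for w
      by (rule orthogonal_to_span[OF that]) (auto simp: orthogonal_def orth)
    from this[OF 2[of i]] show ?thesis by (simp add: orthogonal_def)
  qed
  have "norm (g v) = norm v" if v: "v \<in> span (range x)" for v
  proof -
    have "g v \<bullet> g w = v \<bullet> w" if "w \<in> span (range x)" for w
      using that
    proof (induction rule: span_induct_alt)
      case (step c b w)
      then obtain j where j: "b = x j" by auto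
      then show ?case
        using 1[of v j] v step(2) by (simp add: add scale inner_add_right 3 B3)
    qed (simp add: zero)
    from this[OF v] show ?thesis by (simp add: norm_eq_sqrt_inner)
  qed
  with that[OF g(1) 3] show thesis .
qed

text \<open>
  The orthogonal complement of \<open>S\<close> is no larger than that of its image, so any isometry between the
  complements can be added to \<open>g\<close> along the orthogonal projection onto \<open>S\<close>.
\<close>
lemma linear_isometry_extend:
  fixes g :: "'a::euclidean_space \<Rightarrow> 'b::euclidean_space"
  assumes "linear g" and S: "subspace S"
    and iso: "\<And>v. v \<in> S \<Longrightarrow> norm (g v) = norm v"
    and dim: "DIM('a) \<le> DIM('b)"
  obtains f where "linear f" "\<And>v. v \<in> S \<Longrightarrow> f v = g v" "\<And>v. norm (f v) = norm v"
proof -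
  interpret g: linear g by fact
  define T where "T = g ` S"
  have T: "subspace T" unfolding T_def using linear_subspace_image[OF assms(1) S] .
  define S' where "S' = {v. \<forall>u\<in>S. orthogonal u v}"
  define T' where "T' = {v. \<forall>u\<in>T. orthogonal u v}"
  have sub: "subspace S'" "subspace T'"
    unfolding S'_def T'_def by (auto simp: subspace_orthogonal_to_vectors)
  have "dim S' + dim S = DIM('a)" "dim T' + dim T = DIM('b)"
    using dim_subspace_orthogonal_to_vectors[OF S subspace_UNIV]
      dim_subspace_orthogonal_to_vectors[OF T subspace_UNIV]
    by (simp_all add: S'_def T'_def)
  moreover have "dim T \<le> dim S"
    unfolding T_def by (rule dim_image_le) fact
  ultimately have "dim S' \<le> dim T'" using dim by linarith
  then obtain h where h: "linear h" "h \<in> S' \<rightarrow> T'" "\<And>x. x \<in> S' \<Longrightarrow> norm (h x) = norm x"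
    using isometry_subset_subspace[OF sub] by blast
  interpret h: linear h by fact
  obtain E where E: "E \<subseteq> S" "pairwise orthogonal E" "independent E" "span E = S"
    using orthonormal_basis_subspace[OF S] by metis
  define \<pi> where "\<pi> v = (\<Sum>b\<in>E. (b \<bullet> v / (b \<bullet> b)) *\<^sub>R b)" for v
  have lin: "linear \<pi>"
    unfolding \<pi>_def
    by (rule linearI) (simp_all add: inner_add_right add_divide_distrib scaleR_add_left sum.distrib
        scaleR_sum_right mult_ac)
  interpret \<pi>: linear \<pi> by (rule lin)
  have piS: "\<pi> v \<in> S" for v
    unfolding \<pi>_def using E(1) S by (intro subspace_sum subspace_scale) auto
  have orth: "v - \<pi> v \<in> S'" for v
    unfolding S'_def using Gram_Schmidt_step[OF E(2), of _ v] by (auto simp: E(4) \<pi>_def)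
  define f where "f v = g (\<pi> v) + h (v - \<pi> v)" for v
  show thesis
  proof (rule that[of f])
    show "linear f"
      unfolding f_def
      by (rule linearI)
        (simp_all add: \<pi>.add g.add h.add \<pi>.scale g.scale h.scale h.diff scaleR_add_right
          scaleR_diff_right)
    show "f v = g v" if "v \<in> S" for v
    proof -
      have "v - \<pi> v \<in> S" using that piS S by (intro subspace_diff)
      with orth[of v] have "orthogonal (v - \<pi> v) (v - \<pi> v)" unfolding S'_def by blast
      then have "\<pi> v = v" by (simp add: orthogonal_def)
      then show ?thesis by (simp add: f_def h.zero)
    qed
    show "norm (f v) = norm v" for v
    proof -
      have "orthogonal (g (\<pi> v)) (h (v - \<pi> v))"
        using h(2) orth[of v] piS[of v] by (auto simp: T'_def T_def Pi_iff)
      then have "(norm (f v))\<^sup>2 = (norm (\<pi> v))\<^sup>2 + (norm (v - \<pi> v))\<^sup>2"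
        unfolding f_def by (simp add: norm_add_Pythagorean iso piS h(3) orth)
      also have "\<dots> = (norm (\<pi> v + (v - \<pi> v)))\<^sup>2"
        using orth[of v] piS[of v] by (subst norm_add_Pythagorean) (auto simp: S'_def)
      finally show ?thesis by simp
    qed
  qed
qed

lemma linear_isometry_of_equal_Gram:
  fixes x :: "'i \<Rightarrow> 'a::euclidean_space" and y :: "'i \<Rightarrow> 'b::euclidean_space"
  assumes gram: "\<And>i j. x i \<bullet> x j = y i \<bullet> y j" and dim: "DIM('a) \<le> DIM('b)"
  obtains f where "linear f" "\<And>i. f (x i) = y i" "\<And>v. norm (f v) = norm v"
proof -
  obtain g where g: "linear g" "\<And>i. g (x i) = y i"
    "\<And>v. v \<in> span (range x) \<Longrightarrow> norm (g v) = norm v"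
    using linear_isometry_between_equal_Gram[of x y] gram by metis
  obtain f where "linear f" "\<And>v. v \<in> span (range x) \<Longrightarrow> f v = g v" "\<And>v. norm (f v) = norm v"
    using linear_isometry_extend[OF g(1) subspace_span g(3) dim] by blast
  with that[of f] g(2) show thesis by (simp add: span_base)
qed

lemma transpose_matrix_isometry:
  fixes f :: "real^'a \<Rightarrow> real^'b"
  assumes "linear f" and "\<And>v. norm (f v) = norm v"
  shows "transpose (matrix f) ** matrix f = mat 1"
proof -
  interpret linear f by fact
  have inner: "f u \<bullet> f v = u \<bullet> v" for u v
    using assms(2)[of "u + v"] assms(2)[of u] assms(2)[of v]
    by (simp add: add dot_norm)
  have "(transpose (matrix f) ** matrix f) *v v = v" for v
  proof -
    have "u \<bullet> ((transpose (matrix f) ** matrix f) *v v) = u \<bullet> v" for u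
    proof -
      have "u \<bullet> ((transpose (matrix f) ** matrix f) *v v) = ((matrix f *v v) v* matrix f) \<bullet> u"
        by (simp add: inner_commute flip: matrix_vector_mul_assoc)
      also have "\<dots> = (matrix f *v u) \<bullet> (matrix f *v v)"
        unfolding dot_lmul_matrix by (rule inner_commute)
      finally have "u \<bullet> ((transpose (matrix f) ** matrix f) *v v) = (matrix f *v u) \<bullet> (matrix f *v v)" .
      then show ?thesis using assms(1) by (simp add: inner)
    qed
    then show ?thesis by (meson vector_eq_ldot)
  qed
  then show ?thesis by (simp add: matrix_eq)
qed

text \<open>
  If \<open>p \<le> q\<close>, the matrix is the transpose of an isometry \<open>f\<close> with \<open>f (x i) = y i\<close> and has orthonormal
  rows. If \<open>q < p\<close>, no isometry starts from the larger space; one takes an isometry \<open>f\<close> with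
  \<open>f (y i) = x i\<close>, whose matrix has orthonormal columns and undoes \<open>f\<close> when applied from the right.
\<close>
lemma orthogonal_rect_of_equal_Gram:
  fixes x :: "'i \<Rightarrow> real^'p" and y :: "'i \<Rightarrow> real^'q"
  assumes gram: "\<And>i j. x i \<bullet> x j = y i \<bullet> y j"
  obtains C :: "real^'q^'p" where "orthogonal_rect C" "\<And>i. x i v* C = y i"
proof (cases "CARD('p) \<le> CARD('q)")
  case True
  then obtain f where f: "linear f" "\<And>i. f (x i) = y i" "\<And>v. norm (f v) = norm v"
    using linear_isometry_of_equal_Gram[of x y] gram by auto
  show thesis
  proof (rule that[of "transpose (matrix f)"])
    show "orthogonal_rect (transpose (matrix f))"
      using transpose_matrix_isometry[OF f(1,3)]
      by (simp add: orthogonal_rect_def)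
    show "x i v* transpose (matrix f) = y i" for i
      using f by simp
  qed
next
  case False
  then obtain f where f: "linear f" "\<And>i. f (y i) = x i" "\<And>v. norm (f v) = norm v"
    using linear_isometry_of_equal_Gram[of y x] gram by auto
  note 1 = transpose_matrix_isometry[OF f(1,3)]
  show thesis
  proof (rule that[of "matrix f"])
    show "orthogonal_rect (matrix f)"
      using 1 by (simp add: orthogonal_rect_def)
    show "x i v* matrix f = y i" for i
    proof -
      have "x i = matrix f *v y i" using f by simp
      then have "x i v* matrix f = (transpose (matrix f) ** matrix f) *v y i"
        by (simp flip: matrix_vector_mul_assoc)
      then show ?thesis by (simp add: 1)
    qed
  qed
qed

lemma similar_point_sets:
  fixes X :: "real^'p^'n" and Y :: "real^'q^'n"
  assumes "\<beta> > 0" and dist: "\<And>k l. pair_dist Y k l = \<beta> * pair_dist X k l"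
  obtains a :: "real^'q" and C :: "real^'q^'p"
  where "orthogonal_rect C" "Y = (\<chi> k. a) + \<beta> *\<^sub>R (X ** C)"
proof -
  \<comment> \<open>Any sample point serves as the origin of both point sets.\<close>
  fix k0 :: 'n
  define x where "x k = X $ k - X $ k0" for k
  define y where "y k = (1 / \<beta>) *\<^sub>R (Y $ k - Y $ k0)" for k
  have d: "norm (Y $ k - Y $ l) = \<beta> * norm (X $ k - X $ l)" for k l
    using dist[of k l] by (simp add: pair_dist_def)
  have "x k \<bullet> x l = y k \<bullet> y l" for k l
  proof -
    have "norm (x k) = norm (y k)" for k
      using d[of k k0] assms(1) by (simp add: x_def y_def)
    moreover have "norm (x k - x l) = norm (y k - y l)"
      using d[of k l] assms(1) by (simp add: x_def y_def flip: scaleR_diff_right)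
    ultimately show ?thesis by (simp add: dot_norm_neg)
  qed
  then obtain C :: "real^'q^'p" where C: "orthogonal_rect C" "\<And>k. x k v* C = y k"
    using orthogonal_rect_of_equal_Gram[of x y] by metis
  have Y: "Y $ k = (Y $ k0 - \<beta> *\<^sub>R (X $ k0 v* C)) + \<beta> *\<^sub>R (X $ k v* C)" for k
  proof -
    have "X $ k v* C - X $ k0 v* C = (1 / \<beta>) *\<^sub>R (Y $ k - Y $ k0)"
      using C(2)[of k] by (simp add: x_def y_def vector_matrix_mult_def vec_eq_iff left_diff_distrib sum_subtractf)
    then have "\<beta> *\<^sub>R (X $ k v* C - X $ k0 v* C) = Y $ k - Y $ k0"
      using assms(1) by simp
    then show ?thesis by (simp add: algebra_simps)
  qed
  have XC: "X $ k v* C = (X ** C) $ k" for k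
    by (simp add: vec_eq_iff vector_matrix_mult_def matrix_matrix_mult_def mult_ac)
  have "Y $ k = ((\<chi> k. Y $ k0 - \<beta> *\<^sub>R (X $ k0 v* C)) + \<beta> *\<^sub>R (X ** C)) $ k" for k
    using Y[of k] XC[of k] by simp
  then have "Y = (\<chi> k. Y $ k0 - \<beta> *\<^sub>R (X $ k0 v* C)) + \<beta> *\<^sub>R (X ** C)"
    unfolding vec_eq_iff[of Y] by blast
  then show thesis by (rule that[OF C(1)])
qed

section \<open>Sample distance correlation\<close>

text \<open>
  A matrix annihilated by double centering is a sum of a function of the row and a function of the
  column; symmetry makes the two equal, and the zero diagonal then makes them vanish.
\<close>
lemma double_centered_eq_0_imp_eq_0:
  fixes e :: "'n::finite \<Rightarrow> 'n \<Rightarrow> real"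
  assumes sym: "\<And>k l. e k l = e l k" and diag: "\<And>k. e k k = 0"
    and zero: "\<And>k l. double_centered e k l = 0"
  shows "e k l = 0"
proof -
  define R where "R k = 1 / real CARD('n) * (\<Sum>j\<in>UNIV. e k j)" for k
  define t where "t = 1 / (real CARD('n))\<^sup>2 * (\<Sum>i\<in>UNIV. \<Sum>j\<in>UNIV. e i j)"
  have "(\<Sum>i\<in>UNIV. e i l) = (\<Sum>j\<in>UNIV. e l j)" for l
    by (rule sum.cong) (auto intro: sym)
  then have "e k l = R k + R l - t" for k l
    using zero[of k l] by (simp add: double_centered_def R_def t_def)
  from this[of k l] this[of k k] this[of l l] diag show ?thesis by simp
qed

lemma double_centered_linear:
  fixes a b :: "'n::finite \<Rightarrow> 'n \<Rightarrow> real"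
  shows "double_centered (\<lambda>k l. \<alpha> * a k l - \<beta> * b k l) k l
    = \<alpha> * double_centered a k l - \<beta> * double_centered b k l"
  by (simp add: double_centered_def sum_subtractf right_diff_distrib distrib_left
      sum_distrib_left[symmetric] mult.left_commute)

lemma pair_dist_proportional:
  fixes X :: "real^'p^'n" and Y :: "real^'q^'n"
  assumes "\<And>k l. \<alpha> * double_centered (pair_dist X) k l = \<beta> * double_centered (pair_dist Y) k l"
  shows "\<alpha> * pair_dist X k l = \<beta> * pair_dist Y k l"
proof -
  have "\<alpha> * pair_dist X k l - \<beta> * pair_dist Y k l = 0"
    by (rule double_centered_eq_0_imp_eq_0[where e = "\<lambda>k l. \<alpha> * pair_dist X k l - \<beta> * pair_dist Y k l"])
      (simp_all add: double_centered_linear assms, simp_all add: pair_dist_def norm_minus_commute)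
  then show ?thesis by simp
qed

lemma emp_dvar2_eq: "emp_dvar2 X = emp_dcov2 X X"
  by (simp add: emp_dvar2_def emp_dcov2_def power2_eq_square)

lemma emp_dvar2_nonneg: "0 \<le> emp_dvar2 X"
  by (simp add: emp_dvar2_eq emp_dcov2_nonneg)

text \<open>
  The identity behind the Cauchy-Schwarz inequality, kept in this form because the case of equality
  is needed as well.
\<close>
lemma emp_dcov2_square_gap:
  fixes X :: "real^'p^'n" and Y :: "real^'q^'n"
  shows "(1 / (real CARD('n))\<^sup>2) * (\<Sum>k\<in>UNIV. \<Sum>l\<in>UNIV.
      (\<alpha> * double_centered (pair_dist X) k l - \<beta> * double_centered (pair_dist Y) k l)\<^sup>2)
    = \<alpha>\<^sup>2 * emp_dvar2 X - 2 * \<alpha> * \<beta> * emp_dcov2 X Y + \<beta>\<^sup>2 * emp_dvar2 Y"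
proof -
  have "(\<alpha> * double_centered (pair_dist X) k l - \<beta> * double_centered (pair_dist Y) k l)\<^sup>2
    = \<alpha>\<^sup>2 * (double_centered (pair_dist X) k l)\<^sup>2
      - 2 * \<alpha> * \<beta> * (double_centered (pair_dist X) k l * double_centered (pair_dist Y) k l)
      + \<beta>\<^sup>2 * (double_centered (pair_dist Y) k l)\<^sup>2" for k l
    by (simp add: power2_eq_square algebra_simps)
  then show ?thesis
    by (simp add: emp_dvar2_def emp_dcov2_def sum.distrib sum_subtractf diff_divide_distrib
        add_divide_distrib flip: sum_distrib_left)
qed

lemma emp_dcov2_le:
  fixes X :: "real^'p^'n" and Y :: "real^'q^'n"
  assumes "emp_dvar2 X * emp_dvar2 Y > 0"
  shows "emp_dcov2 X Y \<le> sqrt (emp_dvar2 X * emp_dvar2 Y)"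
    and "emp_dcov2 X Y = sqrt (emp_dvar2 X * emp_dvar2 Y) \<Longrightarrow>
      sqrt (emp_dvar2 Y) * double_centered (pair_dist X) k l
      = sqrt (emp_dvar2 X) * double_centered (pair_dist Y) k l"
proof -
  let ?\<alpha> = "sqrt (emp_dvar2 Y)" and ?\<beta> = "sqrt (emp_dvar2 X)"
  let ?S = "\<Sum>k\<in>UNIV. \<Sum>l\<in>UNIV.
      (?\<alpha> * double_centered (pair_dist X) k l - ?\<beta> * double_centered (pair_dist Y) k l)\<^sup>2"
  let ?g = "sqrt (emp_dvar2 X * emp_dvar2 Y)"
  have *: "(1 / (real CARD('n))\<^sup>2) * ?S = 2 * (emp_dvar2 X * emp_dvar2 Y - ?g * emp_dcov2 X Y)"
    unfolding emp_dcov2_square_gap by (simp add: emp_dvar2_nonneg real_sqrt_mult mult_ac)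
  have sq: "?g * ?g = emp_dvar2 X * emp_dvar2 Y" using assms by simp
  have S: "(1 / (real CARD('n))\<^sup>2) * ?S = 2 * ?g * (?g - emp_dcov2 X Y)"
    unfolding * by (simp only: sq right_diff_distrib mult.assoc)
  have g: "?g > 0" using assms by simp
  have "0 \<le> (1 / (real CARD('n))\<^sup>2) * ?S" by (intro mult_nonneg_nonneg sum_nonneg) auto
  then show "emp_dcov2 X Y \<le> ?g" unfolding S using g by (simp add: zero_le_mult_iff)
  show "?\<alpha> * double_centered (pair_dist X) k l = ?\<beta> * double_centered (pair_dist Y) k l"
    if "emp_dcov2 X Y = ?g"
  proof -
    have "?S = 0" using S that by simp
    then show ?thesis by (simp add: sum_nonneg_eq_0_iff sum_nonneg)
  qed
qed

lemma emp_dcor_bounds: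
  fixes X :: "real^'p^'n" and Y :: "real^'q^'n"
  shows "0 \<le> emp_dcor X Y" "emp_dcor X Y \<le> 1"
  using emp_dcov2_le(1)[of X Y] emp_dcov2_nonneg[of X Y]
  by (auto simp: emp_dcor_def emp_dcor2_def divide_le_eq)

lemma emp_dcor_eq_1_imp_similar:
  fixes X :: "real^'p^'n" and Y :: "real^'q^'n"
  assumes "emp_dcor X Y = 1"
  shows "\<exists>(a :: real^'q) (b :: real) (C :: real^'q^'p).
    b \<noteq> 0 \<and> orthogonal_rect C \<and> Y = (\<chi> k. a) + b *\<^sub>R (X ** C)"
proof -
  have pos: "emp_dvar2 X * emp_dvar2 Y > 0" and eq: "emp_dcov2 X Y = sqrt (emp_dvar2 X * emp_dvar2 Y)"
    using assms by (auto simp: emp_dcor_def emp_dcor2_def split: if_splits)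
  then have p: "emp_dvar2 X > 0" "emp_dvar2 Y > 0"
    using emp_dvar2_nonneg[of X] emp_dvar2_nonneg[of Y] by (auto simp: zero_less_mult_iff)
  define \<beta> where "\<beta> = sqrt (emp_dvar2 Y) / sqrt (emp_dvar2 X)"
  have "sqrt (emp_dvar2 Y) * pair_dist X k l = sqrt (emp_dvar2 X) * pair_dist Y k l" for k l
    by (rule pair_dist_proportional) (rule emp_dcov2_le(2)[OF pos eq])
  then have "pair_dist Y k l = \<beta> * pair_dist X k l" for k l
    using p by (simp add: \<beta>_def field_simps)
  moreover have "\<beta> > 0" using p by (simp add: \<beta>_def)
  ultimately obtain a :: "real^'q" and C :: "real^'q^'p"
    where "orthogonal_rect C" "Y = (\<chi> k. a) + \<beta> *\<^sub>R (X ** C)"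
    by (metis similar_point_sets)
  with \<open>\<beta> > 0\<close> show ?thesis by (intro exI[of _ a] exI[of _ \<beta>] exI[of _ C]) simp
qed

section \<open>Uniqueness of characteristic functions in Euclidean spaces\<close>

text \<open>
  After division by the total mass, the images under \<open>Z\<close> of the measures with density \<open>w\<close> are
  probability measures on the real line, to which the uniqueness theorem of Levy applies. The bound
  \<open>3\<close> only serves integrability; it fits the weights \<open>1\<close> and \<open>2 + g\<close> with \<open>\<bar>g\<bar> \<le> 1\<close> used next.
\<close>
lemma Levy_uniqueness_weighted_pos:
  fixes Z w :: "'a \<Rightarrow> real"
  assumes fin: "finite_measure \<mu>" "finite_measure \<nu>" and sets: "sets \<nu> = sets \<mu>"
    and Z[measurable]: "Z \<in> borel_measurable \<mu>" and w[measurable]: "w \<in> borel_measurable \<mu>"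
    and bound: "\<And>x. 0 \<le> w x" "\<And>x. w x \<le> 3" and pos: "0 < (\<integral>x. w x \<partial>\<mu>)"
    and eq: "\<And>t. (\<integral>x. w x *\<^sub>R iexp (t * Z x) \<partial>\<mu>) = (\<integral>x. w x *\<^sub>R iexp (t * Z x) \<partial>\<nu>)"
    and A[measurable]: "A \<in> sets borel"
  shows "(\<integral>x. w x * indicator A (Z x) \<partial>\<mu>) = (\<integral>x. w x * indicator A (Z x) \<partial>\<nu>)"
proof -
  define m where "m = (\<integral>x. w x \<partial>\<mu>)"
  have m: "m > 0" using pos by (simp add: m_def)
  have "complex_of_real (\<integral>x. w x \<partial>\<mu>) = complex_of_real (\<integral>x. w x \<partial>\<nu>)"
    using eq[of 0] by (simp add: scaleR_conv_of_real)
  then have m': "(\<integral>x. w x \<partial>\<nu>) = m" by (simp add: m_def)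
  define D where "D \<rho> = distr (density \<rho> (\<lambda>x. ennreal (w x / m))) borel Z" for \<rho>
  have D: "real_distribution (D \<rho>)"
    "char (D \<rho>) t = (\<integral>x. w x *\<^sub>R iexp (t * Z x) \<partial>\<rho>) /\<^sub>R m"
    "measure (D \<rho>) A = (\<integral>x. w x * indicator A (Z x) \<partial>\<rho>) / m"
    if \<rho>: "finite_measure \<rho>" "sets \<rho> = sets \<mu>" "(\<integral>x. w x \<partial>\<rho>) = m" for \<rho> t
  proof -
    note [measurable_cong] = \<rho>(2)
    interpret finite_measure \<rho> by fact
    have int: "integrable \<rho> w"
      by (rule integrable_const_bound[of _ 3]) (use bound in auto)
    have int2: "integrable \<rho> (\<lambda>x. w x / m)" using int by simp
    have "emeasure (density \<rho> (\<lambda>x. ennreal (w x / m))) (space \<rho>) = 1"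
      using m bound int2 \<rho>(3)
      by (simp add: emeasure_density nn_integral_eq_integral)
    then have p: "prob_space (density \<rho> (\<lambda>x. ennreal (w x / m)))"
      by (intro prob_spaceI) simp
    then show "real_distribution (D \<rho>)"
      by (auto simp: D_def real_distribution_def real_distribution_axioms_def intro!: prob_space.prob_space_distr)
    show "char (D \<rho>) t = (\<integral>x. w x *\<^sub>R iexp (t * Z x) \<partial>\<rho>) /\<^sub>R m"
      unfolding char_def D_def using m bound
      by (simp add: integral_distr integral_density divide_inverse mult.commute[of _ "inverse m"]
          flip: scaleR_scaleR integral_scaleR_right)
    have "measure (D \<rho>) A = (\<integral>x. indicator A x \<partial>D \<rho>)"
      by (simp add: D_def)
    also have "\<dots> = (\<integral>x. (w x * indicator A (Z x)) / m \<partial>\<rho>)"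
      unfolding D_def using m bound
      by (subst integral_distr) (auto simp: integral_density mult_ac)
    finally show "measure (D \<rho>) A = (\<integral>x. w x * indicator A (Z x) \<partial>\<rho>) / m" by simp
  qed
  note D\<mu> = D[OF fin(1) refl m_def[symmetric]] and D\<nu> = D[OF fin(2) sets m']
  have "D \<mu> = D \<nu>"
    by (rule Levy_uniqueness[OF D\<mu>(1) D\<nu>(1)]) (rule ext, simp only: D\<mu>(2) D\<nu>(2) eq)
  then show ?thesis using D\<mu>(3) D\<nu>(3) m by simp
qed

text \<open>
  One-dimensional uniqueness for complex densities, as it is needed to treat the coordinates one at a
  time. The hypothesis at \<open>- t\<close> is, after conjugation, the hypothesis for \<open>cnj W\<close>; so it passes to the
  real and imaginary parts of \<open>W\<close>, and adding the constant \<open>2\<close> makes these positive weights.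
\<close>
lemma Levy_uniqueness_weighted:
  fixes Z :: "'a \<Rightarrow> real" and W :: "'a \<Rightarrow> complex"
  assumes prob: "prob_space \<mu>" "prob_space \<nu>" and sets: "sets \<nu> = sets \<mu>"
    and Z[measurable]: "Z \<in> borel_measurable \<mu>" and W[measurable]: "W \<in> borel_measurable \<mu>"
    and bound: "\<And>x. cmod (W x) \<le> 1"
    and eq1: "\<And>t. (\<integral>x. iexp (t * Z x) \<partial>\<mu>) = (\<integral>x. iexp (t * Z x) \<partial>\<nu>)"
    and eq: "\<And>t. (\<integral>x. W x * iexp (t * Z x) \<partial>\<mu>) = (\<integral>x. W x * iexp (t * Z x) \<partial>\<nu>)"
    and A[measurable]: "A \<in> sets borel"
  shows "(\<integral>x. W x * indicator A (Z x) \<partial>\<mu>) = (\<integral>x. W x * indicator A (Z x) \<partial>\<nu>)"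
proof -
  interpret \<mu>: prob_space \<mu> by fact
  interpret \<nu>: prob_space \<nu> by fact
  note [measurable_cong] = sets
  have int: "integrable \<rho> (\<lambda>x. V x * F x)"
    if "\<rho> = \<mu> \<or> \<rho> = \<nu>" "V \<in> borel_measurable \<mu>" "F \<in> borel_measurable \<mu>"
      "\<And>x. norm (V x) \<le> 1" "\<And>x. norm (F x) \<le> 1" for \<rho> and V F :: "'a \<Rightarrow> complex"
  proof -
    have "norm (V x * F x) \<le> 1" for x
      using mult_mono[OF that(4,5)[of x]] by (simp add: norm_mult)
    with that show ?thesis
      by (auto intro!: \<mu>.integrable_const_bound[of _ 1] \<nu>.integrable_const_bound[of _ 1])
  qed
  have real_weight: "(\<integral>x. g x * indicator A (Z x) \<partial>\<mu>) = (\<integral>x. g x * indicator A (Z x) \<partial>\<nu>)"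
    if g[measurable]: "g \<in> borel_measurable \<mu>" and gb: "\<And>x. \<bar>g x\<bar> \<le> 1"
      and geq: "\<And>t. (\<integral>x. g x *\<^sub>R iexp (t * Z x) \<partial>\<mu>) = (\<integral>x. g x *\<^sub>R iexp (t * Z x) \<partial>\<nu>)"
    for g :: "'a \<Rightarrow> real"
  proof -
    have gb': "- 1 \<le> g x" "g x \<le> 1" for x using gb[of x] by auto
    have fin: "finite_measure \<mu>" "finite_measure \<nu>" by unfold_locales
    have one: "(\<integral>x. 1 * indicator A (Z x) \<partial>\<mu>) = (\<integral>x. 1 * indicator A (Z x) \<partial>\<nu> :: real)"
      by (rule Levy_uniqueness_weighted_pos[OF fin sets, where w = "\<lambda>_. 1"])
        (use eq1 \<mu>.prob_space in auto)
    have ints: "integrable \<mu> (\<lambda>x. g x *\<^sub>R iexp (t * Z x))" "integrable \<nu> (\<lambda>x. g x *\<^sub>R iexp (t * Z x))"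
      "integrable \<mu> (\<lambda>x. iexp (t * Z x))" "integrable \<nu> (\<lambda>x. iexp (t * Z x))"
      "integrable \<mu> g" "integrable \<nu> g"
      "integrable \<mu> (\<lambda>x. g x * indicator A (Z x))" "integrable \<nu> (\<lambda>x. g x * indicator A (Z x))"
      "integrable \<mu> (\<lambda>x. indicator A (Z x) :: real)" "integrable \<nu> (\<lambda>x. indicator A (Z x) :: real)"
      for t
      by (rule \<mu>.integrable_const_bound[of _ 1] \<nu>.integrable_const_bound[of _ 1];
          auto simp: gb norm_mult split: split_indicator)+
    have two: "(\<integral>x. (2 + g x) * indicator A (Z x) \<partial>\<mu>) = (\<integral>x. (2 + g x) * indicator A (Z x) \<partial>\<nu>)"
    proof (rule Levy_uniqueness_weighted_pos[OF fin sets])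
      show "0 \<le> 2 + g x" "2 + g x \<le> 3" for x using gb'[of x] by auto
      have "- 1 \<le> (\<integral>x. g x \<partial>\<mu>)"
        using \<mu>.integral_ge_const[OF ints(5), of "-1"] gb' by simp
      then show "0 < (\<integral>x. 2 + g x \<partial>\<mu>)"
        using ints(5) \<mu>.prob_space by simp
      show "(\<integral>x. (2 + g x) *\<^sub>R iexp (t * Z x) \<partial>\<mu>) = (\<integral>x. (2 + g x) *\<^sub>R iexp (t * Z x) \<partial>\<nu>)" for t
        using ints(1-4)[of t] geq[of t] eq1[of t] by (simp add: scaleR_add_left)
    qed simp_all
    show ?thesis
      using one two ints(7-10) by (simp add: distrib_right)
  qed
  have cnj_eq: "(\<integral>x. cnj (W x) * iexp (t * Z x) \<partial>\<rho>) = cnj (\<integral>x. W x * iexp ((- t) * Z x) \<partial>\<rho>)"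
    for t and \<rho> :: "'a measure"
    by (subst Bochner_Integration.integral_cnj[symmetric]) (simp add: exp_cnj)
  have eqc: "(\<integral>x. cnj (W x) * iexp (t * Z x) \<partial>\<mu>) = (\<integral>x. cnj (W x) * iexp (t * Z x) \<partial>\<nu>)" for t
    unfolding cnj_eq eq ..
  have cW: "(\<lambda>x. cnj (W x)) \<in> borel_measurable \<mu>"
    by (rule borel_measurable_continuous_on[OF continuous_on_cnj[OF continuous_on_id] W, simplified])
  have ints: "integrable \<mu> (\<lambda>x. W x * iexp (t * Z x))" "integrable \<nu> (\<lambda>x. W x * iexp (t * Z x))"
    "integrable \<mu> (\<lambda>x. cnj (W x) * iexp (t * Z x))" "integrable \<nu> (\<lambda>x. cnj (W x) * iexp (t * Z x))"
    "integrable \<mu> (\<lambda>x. W x * indicator A (Z x))" "integrable \<nu> (\<lambda>x. W x * indicator A (Z x))"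
    for t
    by (rule int; auto simp: bound cW split: split_indicator)+
  have "(\<integral>x. Re (W x) * indicator A (Z x) \<partial>\<mu>) = (\<integral>x. Re (W x) * indicator A (Z x) \<partial>\<nu>)"
  proof (rule real_weight)
    have *: "Re (W x) *\<^sub>R iexp (t * Z x) = (W x * iexp (t * Z x) + cnj (W x) * iexp (t * Z x)) / 2" for x t
      by (simp add: complex_add_cnj scaleR_conv_of_real flip: distrib_right)
    show "(\<integral>x. Re (W x) *\<^sub>R iexp (t * Z x) \<partial>\<mu>) = (\<integral>x. Re (W x) *\<^sub>R iexp (t * Z x) \<partial>\<nu>)" for t
      unfolding * using ints(1-4)[of t] eq[of t] eqc[of t] by simp
    show "\<bar>Re (W x)\<bar> \<le> 1" for x using abs_Re_le_cmod[of "W x"] bound[of x] by linarith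
  qed simp
  moreover have "(\<integral>x. Im (W x) * indicator A (Z x) \<partial>\<mu>) = (\<integral>x. Im (W x) * indicator A (Z x) \<partial>\<nu>)"
  proof (rule real_weight)
    have *: "Im (W x) *\<^sub>R iexp (t * Z x)
        = (W x * iexp (t * Z x) - cnj (W x) * iexp (t * Z x)) / (2 * \<i>)" for x t
      by (simp add: complex_diff_cnj scaleR_conv_of_real
          mult.left_commute[of "complex_of_real (Im (W x))" \<i>] flip: left_diff_distrib)
    show "(\<integral>x. Im (W x) *\<^sub>R iexp (t * Z x) \<partial>\<mu>) = (\<integral>x. Im (W x) *\<^sub>R iexp (t * Z x) \<partial>\<nu>)" for t
      unfolding * using ints(1-4)[of t] eq[of t] eqc[of t] by simp
    show "\<bar>Im (W x)\<bar> \<le> 1" for x using abs_Im_le_cmod[of "W x"] bound[of x] by linarith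
  qed simp
  moreover have "Re (W x * indicator A (Z x)) = Re (W x) * indicator A (Z x)"
    "Im (W x * indicator A (Z x)) = Im (W x) * indicator A (Z x)" for x
    by (auto split: split_indicator)
  ultimately show ?thesis
    using integral_Re[OF ints(5)] integral_Re[OF ints(6)] integral_Im[OF ints(5)] integral_Im[OF ints(6)]
    by (simp add: complex_eq_iff)
qed

text \<open>
  In the integrals of \<open>exp (i (t \<bullet> x))\<close>, indicators of Borel sets of single coordinates are introduced
  one coordinate at a time. This works for all frequencies \<open>t\<close> at once: shifting \<open>t\<close> along a basis
  vector \<open>j\<close> produces the characteristic function in the coordinate \<open>j\<close>, weighted by what has been
  built so far. At \<open>t = 0\<close>, with all coordinates treated, the two measures agree on boxes.
\<close>
theorem char_fun_unique:
  fixes \<mu> \<nu> :: "'a::euclidean_space measure"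
  assumes prob: "prob_space \<mu>" "prob_space \<nu>"
    and sets: "sets \<mu> = sets borel" "sets \<nu> = sets borel"
    and eq: "\<And>t. (\<integral>x. iexp (t \<bullet> x) \<partial>\<mu>) = (\<integral>x. iexp (t \<bullet> x) \<partial>\<nu>)"
  shows "\<mu> = \<nu>"
proof -
  interpret \<mu>: prob_space \<mu> by fact
  interpret \<nu>: prob_space \<nu> by fact
  note [measurable_cong] = sets
  have main: "(\<integral>x. (\<Prod>i\<in>F. indicator (A i) (x \<bullet> i)) * iexp (t \<bullet> x) \<partial>\<mu>)
      = (\<integral>x. (\<Prod>i\<in>F. indicator (A i) (x \<bullet> i)) * iexp (t \<bullet> x) \<partial>\<nu>)"
    if "finite F" "\<And>i. A i \<in> sets borel" for F and A :: "'a \<Rightarrow> real set" and t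
    using that(1)
  proof (induction F arbitrary: t)
    case empty
    show ?case using eq by simp
  next
    case (insert j F)
    note [measurable] = that(2)
    let ?W = "\<lambda>x. (\<Prod>i\<in>F. indicator (A i) (x \<bullet> i)) * iexp (t \<bullet> x)"
    have W: "?W \<in> borel_measurable borel" by measurable
    \<comment> \<open>The induction hypothesis at the shifted frequency is the weighted hypothesis for \<open>j\<close>.\<close>
    have split: "iexp ((t + \<tau> *\<^sub>R j) \<bullet> x) = iexp (t \<bullet> x) * iexp (\<tau> * (x \<bullet> j))" for \<tau> x
      by (simp add: inner_add_left inner_commute[of j] distrib_left exp_add)
    have "(\<integral>x. ?W x * indicator (A j) (x \<bullet> j) \<partial>\<mu>) = (\<integral>x. ?W x * indicator (A j) (x \<bullet> j) \<partial>\<nu>)"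
    proof (rule Levy_uniqueness_weighted[OF prob])
      show "cmod (?W x) \<le> 1" for x
        by (simp add: norm_mult prod_norm[symmetric])
          (auto intro!: prod_le_1 split: split_indicator)
      show "(\<integral>x. iexp (\<tau> * (x \<bullet> j)) \<partial>\<mu>) = (\<integral>x. iexp (\<tau> * (x \<bullet> j)) \<partial>\<nu>)" for \<tau>
        using eq[of "\<tau> *\<^sub>R j"] by (simp add: inner_commute)
      show "(\<integral>x. ?W x * iexp (\<tau> * (x \<bullet> j)) \<partial>\<mu>) = (\<integral>x. ?W x * iexp (\<tau> * (x \<bullet> j)) \<partial>\<nu>)" for \<tau>
        using insert.IH[of "t + \<tau> *\<^sub>R j"] unfolding split by (simp add: mult_ac)
      show "?W \<in> borel_measurable \<mu>" using W by simp
    qed (simp_all add: sets that(2))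
    then show ?case using insert.hyps by (simp add: mult_ac)
  qed
  have box: "emeasure \<mu> (box a b) = emeasure \<nu> (box a b)" for a b
  proof -
    have "(\<Prod>i\<in>Basis. indicator {a \<bullet> i<..<b \<bullet> i} (x \<bullet> i)) = (indicator (box a b) x :: complex)" for x
    proof (cases "x \<in> box a b")
      case False
      then obtain i where "i \<in> Basis" "x \<bullet> i \<notin> {a \<bullet> i<..<b \<bullet> i}" by (auto simp: mem_box)
      then have "(\<Prod>i\<in>Basis. indicator {a \<bullet> i<..<b \<bullet> i} (x \<bullet> i)) = (0 :: complex)"
        by (intro prod_zero bexI[of _ i]) auto
      then show ?thesis using False by simp
    qed (simp add: mem_box)
    moreover have "(\<integral>x. indicator (box a b) x \<partial>\<rho>) = complex_of_real (measure \<rho> (box a b))"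
      if "sets \<rho> = sets borel" "finite_measure \<rho>" for \<rho> :: "'a measure"
    proof -
      have "(\<integral>x. indicator (box a b) x \<partial>\<rho>) = (\<integral>x. complex_of_real (indicator (box a b) x) \<partial>\<rho>)"
        by (simp add: of_real_indicator)
      also have "\<dots> = complex_of_real (measure \<rho> (box a b))"
        using that sets_eq_imp_space_eq[OF that(1)] by (subst integral_complex_of_real) simp
      finally show ?thesis .
    qed
    ultimately have "complex_of_real (measure \<mu> (box a b)) = complex_of_real (measure \<nu> (box a b))"
      using main[of Basis "\<lambda>i. {a \<bullet> i<..<b \<bullet> i}" 0] sets
      \<mu>.finite_measure_axioms \<nu>.finite_measure_axioms by simp
    then show ?thesis by (simp add: \<mu>.emeasure_eq_measure \<nu>.emeasure_eq_measure)
  qed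
  let ?E = "range (\<lambda>(a, b). box a b :: 'a set)"
  let ?A = "\<lambda>n::nat. box (- (real n *\<^sub>R One)) (real n *\<^sub>R One) :: 'a set"
  show "\<mu> = \<nu>"
  proof (rule measure_eqI_generator_eq)
    show "Int_stable ?E"
      by (auto simp: Int_stable_def box_Int_box)
    show "?E \<subseteq> Pow UNIV" "sets \<mu> = sigma_sets UNIV ?E" "sets \<nu> = sigma_sets UNIV ?E"
      by (simp_all add: borel_eq_box sets)
    show "range ?A \<subseteq> ?E" "(\<Union>i. ?A i) = UNIV"
      unfolding UN_box_eq_UNIV by auto
    show "emeasure \<mu> (?A i) \<noteq> \<infinity>" for i by simp
    show "emeasure \<mu> X = emeasure \<nu> X" if "X \<in> ?E" for X
      using that box by auto
  qed
qed

section \<open>Independence in terms of characteristic functions\<close>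

lemma joint_char_fun_eq_char_fun_pair:
  "joint_char_fun M X Y t s = char_fun M (\<lambda>w. (X w, Y w)) (t, s)"
  by (simp add: joint_char_fun_def char_fun_def distrib_left)

lemma char_fun_distr:
  assumes "X \<in> borel_measurable M"
  shows "char_fun M X t = (\<integral>x. iexp (t \<bullet> x) \<partial>distr M borel X)"
  using assms by (simp add: char_fun_def integral_distr)

lemma continuous_on_char_fun:
  fixes X :: "'w \<Rightarrow> 'a::euclidean_space"
  assumes "prob_space M" and [measurable]: "X \<in> borel_measurable M"
  shows "continuous_on UNIV (char_fun M X)"
proof -
  interpret prob_space M by fact
  show ?thesis
    unfolding continuous_on_eq_continuous_at[OF open_UNIV] continuous_at_sequentially
  proof safe
    fix t :: 'a and S assume S: "S \<longlonglongrightarrow> t"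
    show "(char_fun M X \<circ> S) \<longlonglongrightarrow> char_fun M X t"
      unfolding comp_def char_fun_def
      by (rule integral_dominated_convergence[where w="\<lambda>_. 1"]) (auto intro!: tendsto_intros S)
  qed
qed

lemma char_fun_measurable:
  assumes "prob_space M" and "X \<in> borel_measurable M"
  shows "char_fun M X \<in> borel_measurable borel"
  by (intro borel_measurable_continuous_onI continuous_on_char_fun assms)

text \<open>
  Joint integrability is what Fubini's theorem delivers for almost every parameter. It does not make
  both factors integrable, since one of them may vanish almost everywhere, so it is assumed here for
  the product.
\<close>
lemma pair_integral_mult:
  fixes f :: "'a \<Rightarrow> complex" and g :: "'b \<Rightarrow> complex"
  assumes "sigma_finite_measure A" "sigma_finite_measure B"
    and int: "integrable (A \<Otimes>\<^sub>M B) (\<lambda>(x, y). f x * g y)"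
  shows "(\<integral>(x, y). f x * g y \<partial>(A \<Otimes>\<^sub>M B)) = (\<integral>x. f x \<partial>A) * (\<integral>y. g y \<partial>B)"
proof -
  interpret A: sigma_finite_measure A by fact
  interpret B: sigma_finite_measure B by fact
  interpret pair_sigma_finite A B ..
  show ?thesis
    using integral_fst'[OF int] by simp
qed

lemma indep_rvec_iff_distr_pair:
  fixes X :: "'w \<Rightarrow> 'a::euclidean_space" and Y :: "'w \<Rightarrow> 'b::euclidean_space"
  assumes "prob_space M" and X[measurable]: "X \<in> borel_measurable M" and Y[measurable]: "Y \<in> borel_measurable M"
  shows "indep_rvec M X Y \<longleftrightarrow>
    distr M borel X \<Otimes>\<^sub>M distr M borel Y = distr M borel (\<lambda>w. (X w, Y w))"
proof -
  interpret prob_space M by fact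
  interpret X: prob_space "distr M borel X" by (rule prob_space_distr) simp
  interpret Y: prob_space "distr M borel Y" by (rule prob_space_distr) simp
  have rect: "emeasure (distr M borel (\<lambda>w. (X w, Y w))) (A \<times> B)
      = ennreal (prob ((X -` A \<inter> space M) \<inter> (Y -` B \<inter> space M)))"
    if "A \<in> sets borel" "B \<in> sets borel" for A B
  proof -
    have "A \<times> B \<in> sets borel"
      unfolding borel_prod[symmetric] using that by simp
    moreover have "(\<lambda>w. (X w, Y w)) -` (A \<times> B) \<inter> space M
        = (X -` A \<inter> space M) \<inter> (Y -` B \<inter> space M)" by auto
    ultimately show ?thesis by (simp add: emeasure_distr emeasure_eq_measure)
  qed
  have marg: "emeasure (distr M borel X) A * emeasure (distr M borel Y) B
      = ennreal (prob (X -` A \<inter> space M) * prob (Y -` B \<inter> space M))"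
    if "A \<in> sets borel" "B \<in> sets borel" for A B
    using that by (simp add: emeasure_distr emeasure_eq_measure ennreal_mult)
  show ?thesis
  proof
    assume "indep_rvec M X Y"
    then have ind: "prob ((X -` A \<inter> space M) \<inter> (Y -` B \<inter> space M))
        = prob (X -` A \<inter> space M) * prob (Y -` B \<inter> space M)"
      if "A \<in> sets borel" "B \<in> sets borel" for A B
      unfolding indep_rvec_def using that by (intro indep_setD) auto
    show "distr M borel X \<Otimes>\<^sub>M distr M borel Y = distr M borel (\<lambda>w. (X w, Y w))"
    proof (rule pair_measure_eqI)
      show "sigma_finite_measure (distr M borel X)" "sigma_finite_measure (distr M borel Y)"
        by unfold_locales
      show "sets (distr M borel X \<Otimes>\<^sub>M distr M borel Y) = sets (distr M borel (\<lambda>w. (X w, Y w)))"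
        by (simp add: borel_prod[symmetric] cong: sets_pair_measure_cong)
      show "emeasure (distr M borel X) A * emeasure (distr M borel Y) B
          = emeasure (distr M borel (\<lambda>w. (X w, Y w))) (A \<times> B)"
        if "A \<in> sets (distr M borel X)" "B \<in> sets (distr M borel Y)" for A B
        using that by (simp add: rect marg ind)
    qed
  next
    assume eq: "distr M borel X \<Otimes>\<^sub>M distr M borel Y = distr M borel (\<lambda>w. (X w, Y w))"
    show "indep_rvec M X Y"
      unfolding indep_rvec_def
    proof (rule indep_setI)
      fix a b
      assume "a \<in> {X -` A \<inter> space M |A. A \<in> sets borel}" "b \<in> {Y -` B \<inter> space M |B. B \<in> sets borel}"
      then obtain A B where AB: "A \<in> sets borel" "B \<in> sets borel"
        "a = X -` A \<inter> space M" "b = Y -` B \<inter> space M" by blast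
      have "ennreal (prob (a \<inter> b)) = emeasure (distr M borel X \<Otimes>\<^sub>M distr M borel Y) (A \<times> B)"
        unfolding eq rect[OF AB(1,2)] AB(3,4) ..
      also have "\<dots> = ennreal (prob a * prob b)"
        using AB by (simp add: Y.emeasure_pair_measure_Times marg)
      finally show "prob (a \<inter> b) = prob a * prob b" by simp
    qed auto
  qed
qed

text \<open>
  Independence says that the joint distribution is the product of the marginals, and the product of
  the marginal characteristic functions is the characteristic function of that product measure.
\<close>
theorem indep_rvec_iff_char_fun:
  fixes X :: "'w \<Rightarrow> 'a::euclidean_space" and Y :: "'w \<Rightarrow> 'b::euclidean_space"
  assumes M: "prob_space M" and X[measurable]: "X \<in> borel_measurable M" and Y[measurable]: "Y \<in> borel_measurable M"
  shows "indep_rvec M X Y \<longleftrightarrow> (\<forall>t s. joint_char_fun M X Y t s = char_fun M X t * char_fun M Y s)"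
proof -
  interpret prob_space M by fact
  interpret X: prob_space "distr M borel X" by (rule prob_space_distr) simp
  interpret Y: prob_space "distr M borel Y" by (rule prob_space_distr) simp
  interpret XY: pair_prob_space "distr M borel X" "distr M borel Y" ..
  let ?\<nu> = "distr M borel X \<Otimes>\<^sub>M distr M borel Y" and ?\<mu> = "distr M borel (\<lambda>w. (X w, Y w))"
  have sets: "sets ?\<nu> = sets (borel :: ('a \<times> 'b) measure)"
  proof -
    have "sets ?\<nu> = sets (borel \<Otimes>\<^sub>M borel)" by (rule sets_pair_measure_cong) simp_all
    then show ?thesis by (simp only: borel_prod)
  qed
  have prod: "(\<integral>x. iexp (p \<bullet> x) \<partial>?\<nu>) = char_fun M X (fst p) * char_fun M Y (snd p)" for p
  proof -
    have "(\<integral>x. iexp (p \<bullet> x) \<partial>?\<nu>) = (\<integral>(x, y). iexp (fst p \<bullet> x) * iexp (snd p \<bullet> y) \<partial>?\<nu>)"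
      by (cases p) (simp add: case_prod_beta' inner_prod_def distrib_left exp_add)
    also have "\<dots> = (\<integral>x. iexp (fst p \<bullet> x) \<partial>distr M borel X) * (\<integral>y. iexp (snd p \<bullet> y) \<partial>distr M borel Y)"
    proof (rule pair_integral_mult)
      show "integrable ?\<nu> (\<lambda>(x, y). iexp (fst p \<bullet> x) * iexp (snd p \<bullet> y))"
        by (rule XY.integrable_const_bound[of _ 1]) (auto simp: norm_mult case_prod_beta')
    qed unfold_locales
    finally show ?thesis by (simp add: char_fun_distr)
  qed
  have joint: "(\<integral>x. iexp (p \<bullet> x) \<partial>?\<mu>) = joint_char_fun M X Y (fst p) (snd p)" for p
    by (simp add: joint_char_fun_eq_char_fun_pair char_fun_distr)
  show ?thesis
    unfolding indep_rvec_iff_distr_pair[OF assms]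
  proof
    assume "?\<nu> = ?\<mu>"
    then show "\<forall>t s. joint_char_fun M X Y t s = char_fun M X t * char_fun M Y s"
      using prod[of "(t, s)" for t s] joint[of "(t, s)" for t s] by simp
  next
    assume *: "\<forall>t s. joint_char_fun M X Y t s = char_fun M X t * char_fun M Y s"
    show "?\<nu> = ?\<mu>"
    proof (rule char_fun_unique)
      show "prob_space ?\<nu>" by unfold_locales
      show "prob_space ?\<mu>" by (rule prob_space_distr) simp
      show "(\<integral>x. iexp (p \<bullet> x) \<partial>?\<nu>) = (\<integral>x. iexp (p \<bullet> x) \<partial>?\<mu>)" for p
        unfolding prod joint using * by simp
    qed (simp_all only: sets sets_distr)
  qed
qed

section \<open>Integrability against the singular weight\<close>

lemma one_minus_cos_le:
  fixes u v :: real
  assumes "\<bar>u\<bar> \<le> v"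
  shows "1 - cos u \<le> 4 * (v\<^sup>2 / (1 + v\<^sup>2))"
proof -
  have uv: "u\<^sup>2 \<le> v\<^sup>2" using assms by (simp add: abs_le_square_iff[symmetric])
  have "1 - cos u \<le> 2" using cos_ge_minus_one[of u] by linarith
  moreover have "1 - cos u \<le> v\<^sup>2 / 2"
  proof -
    have "1 - cos u = 2 * (sin (u / 2))\<^sup>2"
      using cos_double_sin[of "u / 2"] by simp
    also have "(sin (u / 2))\<^sup>2 \<le> (u / 2)\<^sup>2"
      using abs_sin_x_le_abs_x[of "u / 2"] by (simp only: abs_le_square_iff)
    finally show ?thesis using uv by (simp add: power_divide)
  qed
  moreover have "(1 - cos u) * v\<^sup>2 \<le> 2 * v\<^sup>2"
    using calculation(1) by (intro mult_right_mono) auto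
  ultimately have "(1 - cos u) * (1 + v\<^sup>2) \<le> 4 * v\<^sup>2"
    unfolding distrib_left mult_1_right using zero_le_power2[of v] by linarith
  moreover have "1 + v\<^sup>2 > 0" by (intro add_pos_nonneg) auto
  ultimately have "1 - cos u \<le> 4 * v\<^sup>2 / (1 + v\<^sup>2)" by (simp only: pos_le_divide_eq)
  then show ?thesis by simp
qed

text \<open>
  A layer-cake majorant: \<open>1 / norm t ^ (1 + d)\<close> is replaced by an integral over radii \<open>r\<close> between
  \<open>norm t\<close> and \<open>2 * norm t\<close>, an interval of length \<open>norm t\<close>. On it \<open>v\<^sup>2 / (1 + v\<^sup>2)\<close> is larger at
  \<open>r * norm x\<close> than at \<open>norm t * norm x\<close>, and \<open>1 / r ^ (d + 2)\<close> loses at most a factor \<open>2 ^ (d + 2)\<close>;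
  the remaining factor \<open>4\<close> comes from the bound on \<open>1 - cos\<close>. The dependence on \<open>t\<close> that is left
  is only through a condition on its norm.
\<close>
lemma one_minus_cos_div_norm_power_le_layers:
  fixes t x :: "'a::euclidean_space"
  defines "d \<equiv> DIM('a)"
  shows "ennreal ((1 - cos (t \<bullet> x)) / norm t ^ (1 + d))
    \<le> (\<integral>\<^sup>+r. ennreal (2 ^ (d + 4) * ((r * norm x)\<^sup>2 / (1 + (r * norm x)\<^sup>2)) / r ^ (d + 2))
          * indicator {norm t <..< 2 * norm t} r \<partial>lborel)"
proof (cases "t = 0")
  case False
  define \<tau> where "\<tau> = norm t"
  have \<tau>: "\<tau> > 0" using False by (simp add: \<tau>_def)
  define \<phi> where "\<phi> u = u\<^sup>2 / (1 + u\<^sup>2)" for u :: real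
  have \<phi>_mono: "\<phi> u \<le> \<phi> v" if "0 \<le> u" "u \<le> v" for u v
  proof -
    have "u\<^sup>2 \<le> v\<^sup>2" using that by (intro power_mono)
    moreover have "1 + u\<^sup>2 > 0" "1 + v\<^sup>2 > 0" by (auto intro: add_pos_nonneg)
    ultimately show ?thesis
      unfolding \<phi>_def
      by (simp only: pos_divide_le_eq times_divide_eq_left pos_le_divide_eq) (simp add: algebra_simps)
  qed
  have \<phi>_nn: "0 \<le> \<phi> u" for u by (simp add: \<phi>_def)
  have "1 - cos (t \<bullet> x) \<le> 4 * \<phi> (\<tau> * norm x)"
    unfolding \<phi>_def \<tau>_def by (rule one_minus_cos_le) (rule Cauchy_Schwarz_ineq2)
  then have "(1 - cos (t \<bullet> x)) / \<tau> ^ (1 + d) \<le> 4 * \<phi> (\<tau> * norm x) / \<tau> ^ (1 + d)"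
    using \<tau> by (intro divide_right_mono) auto
  then have "ennreal ((1 - cos (t \<bullet> x)) / \<tau> ^ (1 + d)) \<le> ennreal (4 * \<phi> (\<tau> * norm x) / \<tau> ^ (1 + d))"
    by (rule ennreal_leI)
  also have "4 * \<phi> (\<tau> * norm x) / \<tau> ^ (1 + d) = 4 * \<phi> (\<tau> * norm x) / \<tau> ^ (d + 2) * \<tau>"
    using \<tau> by (simp add: field_simps)
  also have "ennreal \<dots> = (\<integral>\<^sup>+r. ennreal (4 * \<phi> (\<tau> * norm x) / \<tau> ^ (d + 2)) * indicator {\<tau> <..< 2 * \<tau>} r \<partial>lborel)"
  proof -
    have "0 \<le> 4 * \<phi> (\<tau> * norm x) / \<tau> ^ (d + 2)" using \<tau> \<phi>_nn by simp
    then show ?thesis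
      using \<tau> by (subst nn_integral_cmult_indicator) (simp_all add: ennreal_mult del: times_divide_eq_left)
  qed
  also have "\<dots> \<le> (\<integral>\<^sup>+r. ennreal (2 ^ (d + 4) * \<phi> (r * norm x) / r ^ (d + 2))
          * indicator {\<tau> <..< 2 * \<tau>} r \<partial>lborel)"
  proof (intro nn_integral_mono)
    fix r
    have "4 * \<phi> (\<tau> * norm x) / \<tau> ^ (d + 2) \<le> 2 ^ (d + 4) * \<phi> (r * norm x) / r ^ (d + 2)"
      if r: "\<tau> < r" "r < 2 * \<tau>"
    proof -
      have "4 * \<phi> (\<tau> * norm x) \<le> 4 * \<phi> (r * norm x)"
        using r \<tau> by (intro mult_left_mono \<phi>_mono mult_right_mono) auto
      moreover have "r ^ (d + 2) \<le> (2 * \<tau>) ^ (d + 2)"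
        using r \<tau> by (intro power_mono) auto
      ultimately have "4 * \<phi> (\<tau> * norm x) * r ^ (d + 2) \<le> 4 * \<phi> (r * norm x) * (2 * \<tau>) ^ (d + 2)"
        using r \<tau> \<phi>_nn by (intro mult_mono) auto
      also have "\<dots> = 2 ^ (d + 4) * \<phi> (r * norm x) * \<tau> ^ (d + 2)"
        by (simp add: power_mult_distrib power_add)
      finally show ?thesis
        using r \<tau> by (simp add: divide_le_eq pos_le_divide_eq mult_ac)
    qed
    then show "ennreal (4 * \<phi> (\<tau> * norm x) / \<tau> ^ (d + 2)) * indicator {\<tau> <..< 2 * \<tau>} r
      \<le> ennreal (2 ^ (d + 4) * \<phi> (r * norm x) / r ^ (d + 2)) * indicator {\<tau> <..< 2 * \<tau>} r"
      by (auto split: split_indicator intro: ennreal_leI)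
  qed
  finally show ?thesis by (simp add: \<phi>_def \<tau>_def)
qed simp

text \<open>
  After exchanging the integrals, the set of \<open>t\<close> belonging to a radius \<open>r\<close> lies in a ball of volume
  proportional to \<open>r ^ d\<close>. This cancels the dimension and leaves a one-dimensional integral over \<open>r\<close>,
  which scales linearly in \<open>norm x\<close>.
\<close>
lemma integral_one_minus_cos_bound:
  "\<exists>C\<ge>0. \<forall>x :: 'a::euclidean_space.
    (\<integral>\<^sup>+t. ennreal ((1 - cos (t \<bullet> x)) / norm t ^ (1 + DIM('a))) \<partial>lborel) \<le> ennreal (C * norm x)"
proof -
  let ?d = "DIM('a)"
  define I where "I = (\<integral>x. inverse (1 + (x::real)\<^sup>2) \<partial>lborel)"
  define V where "V = unit_ball_vol (real ?d)"
  define C where "C = 2 ^ (?d + 4) * V * I"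
  have V: "V \<ge> 0" by (simp add: V_def)
  have I: "I \<ge> 0" unfolding I_def by (intro Bochner_Integration.integral_nonneg) simp
  have C: "0 \<le> C" using V I by (simp add: C_def)
  have nnI: "(\<integral>\<^sup>+u. ennreal (inverse (1 + (u::real)\<^sup>2)) \<partial>lborel) = ennreal I"
    unfolding I_def by (intro nn_integral_eq_integral integrable_inverse_one_plus_square) simp
  have "(\<integral>\<^sup>+t. ennreal ((1 - cos (t \<bullet> x)) / norm t ^ (1 + ?d)) \<partial>lborel) \<le> ennreal (C * norm x)"
    for x :: 'a
  proof (cases "x = 0")
    case False
    define a where "a = norm x"
    have a: "a > 0" using False by (simp add: a_def)
    define k where "k r = 2 ^ (?d + 4) * ((r * a)\<^sup>2 / (1 + (r * a)\<^sup>2)) / r ^ (?d + 2)" for r :: real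
    have [measurable]: "k \<in> borel_measurable borel" unfolding k_def by measurable
    have "(\<integral>\<^sup>+t. ennreal ((1 - cos (t \<bullet> x)) / norm t ^ (1 + ?d)) \<partial>lborel)
      \<le> (\<integral>\<^sup>+t. \<integral>\<^sup>+r. ennreal (k r) * indicator {norm t <..< 2 * norm t} r \<partial>lborel \<partial>(lborel :: 'a measure))"
      unfolding k_def a_def by (intro nn_integral_mono one_minus_cos_div_norm_power_le_layers)
    also have "\<dots> = (\<integral>\<^sup>+t. \<integral>\<^sup>+r. ennreal (k r) * (if norm t < r \<and> r < 2 * norm t then 1 else 0) \<partial>lborel \<partial>(lborel :: 'a measure))"
      by (intro nn_integral_cong) (auto split: split_indicator)
    also have "\<dots> = (\<integral>\<^sup>+r. \<integral>\<^sup>+t. ennreal (k r) * (if norm t < r \<and> r < 2 * norm t then 1 else 0) \<partial>(lborel :: 'a measure) \<partial>lborel)"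
      by (rule lborel_pair.Fubini'[symmetric]) measurable
    also have "\<dots> \<le> (\<integral>\<^sup>+r. ennreal (2 ^ (?d + 4) * V * a\<^sup>2) * ennreal (inverse (1 + (0 + a * r)\<^sup>2)) \<partial>lborel)"
    proof (intro nn_integral_mono)
      fix r :: real
      show "(\<integral>\<^sup>+t. ennreal (k r) * (if norm t < r \<and> r < 2 * norm t then 1 else 0) \<partial>(lborel :: 'a measure))
        \<le> ennreal (2 ^ (?d + 4) * V * a\<^sup>2) * ennreal (inverse (1 + (0 + a * r)\<^sup>2))"
      proof (cases "r > 0")
        case True
        have "(\<integral>\<^sup>+t. ennreal (k r) * (if norm t < r \<and> r < 2 * norm t then 1 else 0) \<partial>(lborel :: 'a measure))
          \<le> (\<integral>\<^sup>+t. ennreal (k r) * indicator (cball 0 r) t \<partial>(lborel :: 'a measure))"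
          by (intro nn_integral_mono) (auto split: split_indicator)
        also have "\<dots> = ennreal (k r) * emeasure lborel (cball (0::'a) r)"
          by (rule nn_integral_cmult_indicator) simp
        also have "\<dots> = ennreal (k r * (V * r ^ ?d))"
        proof -
          have "0 \<le> k r" using True by (simp add: k_def)
          then show ?thesis using True by (simp add: emeasure_cball V_def ennreal_mult)
        qed
        also have "k r * (V * r ^ ?d) = 2 ^ (?d + 4) * V * a\<^sup>2 * inverse (1 + (0 + a * r)\<^sup>2)"
        proof -
          have "1 + (a * r)\<^sup>2 \<noteq> 0" using zero_le_power2[of "a * r"] by linarith
          then show ?thesis
            using True by (simp add: k_def power_add mult.commute[of r a] divide_simps)
              (simp add: power2_eq_square)
        qed
        finally show ?thesis using V by (simp add: ennreal_mult)
      next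
        case False
        then have "(if norm t < r \<and> r < 2 * norm t then 1 else 0) = (0::ennreal)" for t :: 'a
          using norm_ge_zero[of t] by auto
        then show ?thesis by simp
      qed
    qed
    also have "\<dots> = ennreal (2 ^ (?d + 4) * V * a\<^sup>2) * (\<integral>\<^sup>+r. ennreal (inverse (1 + (0 + a * r)\<^sup>2)) \<partial>lborel)"
      by (rule nn_integral_cmult) measurable
    also have "\<dots> = ennreal (2 ^ (?d + 4) * V * a) * (ennreal a * (\<integral>\<^sup>+r. ennreal (inverse (1 + (0 + a * r)\<^sup>2)) \<partial>lborel))"
      using a V by (simp add: power2_eq_square ennreal_mult mult_ac)
    also have "ennreal a * (\<integral>\<^sup>+r. ennreal (inverse (1 + (0 + a * r)\<^sup>2)) \<partial>lborel) = ennreal I"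
      using nn_integral_real_affine[of "\<lambda>u. ennreal (inverse (1 + u\<^sup>2))" a 0] a nnI by simp
    also have "ennreal (2 ^ (?d + 4) * V * a) * ennreal I = ennreal (C * norm x)"
      using a V I by (simp add: C_def a_def ennreal_mult[symmetric] mult_ac)
    finally show ?thesis .
  qed simp
  with C show ?thesis by blast
qed

section \<open>Integrated squared mixed moments\<close>

definition cov_kernel :: "'t measure \<Rightarrow> ('t \<Rightarrow> 'w \<Rightarrow> complex) \<Rightarrow> 'w \<Rightarrow> 'w \<Rightarrow> complex" where
  "cov_kernel T u w w' = (\<integral>t. u t w * cnj (u t w') \<partial>T)"

text \<open>
  The squared modulus of an expectation is an expectation over two independent copies \<open>w\<close>, \<open>w'\<close>.
  Integrated over \<open>(t, s)\<close> first, the product form of the integrand separates \<open>t\<close> from \<open>s\<close> and leaves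
  a product of two kernels.

  Absolute convergence cannot be read off from bounds on the kernels, since products of functions of
  the two vectors need not have finite expectation. It follows from the Cauchy-Schwarz inequality in
  \<open>w\<close> at each fixed \<open>(t, s)\<close>.
\<close>
lemma
  fixes u :: "'t \<Rightarrow> 'w \<Rightarrow> complex" and v :: "'s \<Rightarrow> 'w \<Rightarrow> complex"
  assumes sf: "sigma_finite_measure M" "sigma_finite_measure T" "sigma_finite_measure S"
    and u[measurable]: "case_prod u \<in> borel_measurable (T \<Otimes>\<^sub>M M)"
    and v[measurable]: "case_prod v \<in> borel_measurable (S \<Otimes>\<^sub>M M)"
    and ufin: "(\<integral>\<^sup>+t. \<integral>\<^sup>+w. ennreal ((cmod (u t w))\<^sup>2) \<partial>M \<partial>T) < \<infinity>"
    and vfin: "(\<integral>\<^sup>+s. \<integral>\<^sup>+w. ennreal ((cmod (v s w))\<^sup>2) \<partial>M \<partial>S) < \<infinity>"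
  shows integrable_mixed_moment:
      "integrable (T \<Otimes>\<^sub>M S) (\<lambda>(t, s). (cmod (\<integral>w. u t w * v s w \<partial>M))\<^sup>2)"
    and integrable_cov_kernel_mult:
      "integrable (M \<Otimes>\<^sub>M M) (\<lambda>(w, w'). cov_kernel T u w w' * cov_kernel S v w w')"
    and integral_mixed_moment:
      "complex_of_real (\<integral>(t, s). (cmod (\<integral>w. u t w * v s w \<partial>M))\<^sup>2 \<partial>(T \<Otimes>\<^sub>M S))
        = (\<integral>(w, w'). cov_kernel T u w w' * cov_kernel S v w w' \<partial>(M \<Otimes>\<^sub>M M))"
proof -
  interpret M: sigma_finite_measure M by fact
  interpret T: sigma_finite_measure T by fact
  interpret S: sigma_finite_measure S by fact
  interpret MM: pair_sigma_finite M M ..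
  interpret TS: pair_sigma_finite T S ..
  have sfTS: "sigma_finite_measure (T \<Otimes>\<^sub>M S)" and sfMM: "sigma_finite_measure (M \<Otimes>\<^sub>M M)"
    using TS.sigma_finite_measure_axioms MM.sigma_finite_measure_axioms by auto
  interpret TSMM: pair_sigma_finite "T \<Otimes>\<^sub>M S" "M \<Otimes>\<^sub>M M"
    using sfTS sfMM by (simp add: pair_sigma_finite_def)
  have [measurable]: "(\<lambda>x. u (f x) (g x)) \<in> borel_measurable N"
    if "f \<in> measurable N T" "g \<in> measurable N M" for f g and N :: "'x measure"
    using measurable_compose[OF measurable_Pair[OF that] u] by simp
  have [measurable]: "(\<lambda>x. v (f x) (g x)) \<in> borel_measurable N"
    if "f \<in> measurable N S" "g \<in> measurable N M" for f g and N :: "'x measure"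
    using measurable_compose[OF measurable_Pair[OF that] v] by simp
  have [measurable]: "cnj \<in> borel_measurable borel"
    by (intro borel_measurable_continuous_onI continuous_on_cnj continuous_on_id)
  define h where "h z = (u (fst (fst z)) (fst (snd z)) * v (snd (fst z)) (fst (snd z)))
    * cnj (u (fst (fst z)) (snd (snd z)) * v (snd (fst z)) (snd (snd z)))"
    for z :: "('t \<times> 's) \<times> ('w \<times> 'w)"
  have [measurable]: "h \<in> borel_measurable ((T \<Otimes>\<^sub>M S) \<Otimes>\<^sub>M (M \<Otimes>\<^sub>M M))"
    unfolding h_def by measurable
  have int: "integrable ((T \<Otimes>\<^sub>M S) \<Otimes>\<^sub>M (M \<Otimes>\<^sub>M M)) h"
  proof (rule integrableI_bounded)
    let ?U = "\<lambda>t. \<integral>\<^sup>+w. ennreal ((cmod (u t w))\<^sup>2) \<partial>M"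
    let ?V = "\<lambda>s. \<integral>\<^sup>+w. ennreal ((cmod (v s w))\<^sup>2) \<partial>M"
    have "(\<integral>\<^sup>+z. ennreal (norm (h z)) \<partial>((T \<Otimes>\<^sub>M S) \<Otimes>\<^sub>M (M \<Otimes>\<^sub>M M)))
      = (\<integral>\<^sup>+t. \<integral>\<^sup>+s. \<integral>\<^sup>+w. \<integral>\<^sup>+w'. ennreal (norm (h ((t, s), (w, w')))) \<partial>M \<partial>M \<partial>S \<partial>T)"
    proof -
      have "(\<integral>\<^sup>+z. ennreal (norm (h z)) \<partial>((T \<Otimes>\<^sub>M S) \<Otimes>\<^sub>M (M \<Otimes>\<^sub>M M)))
        = (\<integral>\<^sup>+y. \<integral>\<^sup>+x. ennreal (norm (h (y, x))) \<partial>(M \<Otimes>\<^sub>M M) \<partial>(T \<Otimes>\<^sub>M S))"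
        by (rule sigma_finite_measure.nn_integral_fst[OF sfMM, symmetric]) measurable
      also have "\<dots> = (\<integral>\<^sup>+y. \<integral>\<^sup>+w. \<integral>\<^sup>+w'. ennreal (norm (h (y, (w, w')))) \<partial>M \<partial>M \<partial>(T \<Otimes>\<^sub>M S))"
        by (intro nn_integral_cong M.nn_integral_fst[symmetric]) measurable
      also have "\<dots> = (\<integral>\<^sup>+t. \<integral>\<^sup>+s. \<integral>\<^sup>+w. \<integral>\<^sup>+w'. ennreal (norm (h ((t, s), (w, w')))) \<partial>M \<partial>M \<partial>S \<partial>T)"
        by (rule S.nn_integral_fst[symmetric]) measurable
      finally show ?thesis .
    qed
    also have "\<dots> \<le> (\<integral>\<^sup>+t. \<integral>\<^sup>+s. ?U t * ?V s \<partial>S \<partial>T)"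
    proof (intro nn_integral_mono)
      fix t s assume [measurable]: "t \<in> space T" "s \<in> space S"
      let ?f = "\<lambda>w. ennreal (cmod (u t w)) * ennreal (cmod (v s w))"
      have [measurable]: "u t \<in> borel_measurable M" "v s \<in> borel_measurable M" by measurable
      have "(\<integral>\<^sup>+w. \<integral>\<^sup>+w'. ennreal (norm (h ((t, s), (w, w')))) \<partial>M \<partial>M) = (\<integral>\<^sup>+w. \<integral>\<^sup>+w'. ?f w * ?f w' \<partial>M \<partial>M)"
        by (simp add: h_def norm_mult ennreal_mult mult_ac)
      also have "\<dots> = (\<integral>\<^sup>+w. ?f w \<partial>M)\<^sup>2"
        by (simp add: nn_integral_cmult nn_integral_multc power2_eq_square)
      also have "\<dots> \<le> ?U t * ?V s"
        using Cauchy_Schwarz_nn_integral[of "\<lambda>w. ennreal (cmod (u t w))" M "\<lambda>w. ennreal (cmod (v s w))"]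
        by (simp add: ennreal_power)
      finally show "(\<integral>\<^sup>+w. \<integral>\<^sup>+w'. ennreal (norm (h ((t, s), (w, w')))) \<partial>M \<partial>M) \<le> ?U t * ?V s" .
    qed
    also have "\<dots> = (\<integral>\<^sup>+t. ?U t \<partial>T) * (\<integral>\<^sup>+s. ?V s \<partial>S)"
      by (simp add: nn_integral_cmult nn_integral_multc)
    also have "\<dots> < \<infinity>"
      using ufin vfin by (simp add: ennreal_mult_less_top)
    finally show "(\<integral>\<^sup>+z. ennreal (norm (h z)) \<partial>((T \<Otimes>\<^sub>M S) \<Otimes>\<^sub>M (M \<Otimes>\<^sub>M M))) < \<infinity>" .
  qed measurable
  have int': "integrable ((T \<Otimes>\<^sub>M S) \<Otimes>\<^sub>M (M \<Otimes>\<^sub>M M)) (\<lambda>(z, x). h (z, x))"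
    using int by simp
  let ?D = "\<lambda>(t, s). (cmod (\<integral>w. u t w * v s w \<partial>M))\<^sup>2"
  let ?K = "\<lambda>(w, w'). cov_kernel T u w w' * cov_kernel S v w w'"
  have [measurable]: "?D \<in> borel_measurable (T \<Otimes>\<^sub>M S)"
    by measurable
  have [measurable]: "?K \<in> borel_measurable (M \<Otimes>\<^sub>M M)"
    unfolding cov_kernel_def by measurable
  have D: "AE z in T \<Otimes>\<^sub>M S. (\<integral>x. h (z, x) \<partial>(M \<Otimes>\<^sub>M M)) = complex_of_real (?D z)"
    using TSMM.AE_integrable_fst'[OF int]
  proof eventually_elim
    case (elim z)
    obtain t s where z: "z = (t, s)" by (cases z)
    have eq: "(\<lambda>x. h (z, x)) = (\<lambda>(w, w'). (u t w * v s w) * cnj (u t w' * v s w'))"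
      by (auto simp: h_def z)
    have "(\<integral>x. h (z, x) \<partial>(M \<Otimes>\<^sub>M M)) = (\<integral>w. u t w * v s w \<partial>M) * (\<integral>w. cnj (u t w * v s w) \<partial>M)"
      unfolding eq by (rule pair_integral_mult[OF sf(1,1)]) (use elim in \<open>simp add: eq\<close>)
    also have "\<dots> = complex_of_real (?D z)"
      unfolding Bochner_Integration.integral_cnj z by (simp add: complex_norm_square del: of_real_power)
    finally show ?case .
  qed
  have K: "AE x in M \<Otimes>\<^sub>M M. (\<integral>z. h (z, x) \<partial>(T \<Otimes>\<^sub>M S)) = ?K x"
    using TSMM.AE_integrable_snd[OF int']
  proof eventually_elim
    case (elim x)
    obtain w w' where x: "x = (w, w')" by (cases x)
    have eq: "(\<lambda>z. h (z, (w, w'))) = (\<lambda>(t, s). (u t w * cnj (u t w')) * (v s w * cnj (v s w')))"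
      by (auto simp: h_def mult_ac)
    show ?case
      unfolding x eq cov_kernel_def
      by (subst pair_integral_mult[OF sf(2,3)]) (use elim in \<open>simp_all add: x eq\<close>)
  qed
  have "integrable (T \<Otimes>\<^sub>M S) (\<lambda>z. complex_of_real (?D z))"
    using TSMM.integrable_fst'[OF int] D
    by (subst integrable_cong_AE[where g = "\<lambda>z. \<integral>x. h (z, x) \<partial>(M \<Otimes>\<^sub>M M)"]) auto
  then show "integrable (T \<Otimes>\<^sub>M S) ?D"
    unfolding complex_of_real_integrable_eq .
  have "integrable (M \<Otimes>\<^sub>M M) (\<lambda>x. \<integral>z. h (z, x) \<partial>(T \<Otimes>\<^sub>M S))"
    using TSMM.integrable_snd[OF int'] .
  then show "integrable (M \<Otimes>\<^sub>M M) ?K"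
    using K by (subst integrable_cong_AE[where g = "\<lambda>x. \<integral>z. h (z, x) \<partial>(T \<Otimes>\<^sub>M S)"]) auto
  have "complex_of_real (\<integral>z. ?D z \<partial>(T \<Otimes>\<^sub>M S)) = (\<integral>z. complex_of_real (?D z) \<partial>(T \<Otimes>\<^sub>M S))"
    by (rule integral_complex_of_real[symmetric])
  also have "\<dots> = (\<integral>z. \<integral>x. h (z, x) \<partial>(M \<Otimes>\<^sub>M M) \<partial>(T \<Otimes>\<^sub>M S))"
    using D by (intro integral_cong_AE) auto
  also have "\<dots> = (\<integral>x. \<integral>z. h (z, x) \<partial>(T \<Otimes>\<^sub>M S) \<partial>(M \<Otimes>\<^sub>M M))"
    using TSMM.Fubini_integral[OF int'] by simp
  also have "\<dots> = (\<integral>x. ?K x \<partial>(M \<Otimes>\<^sub>M M))"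
    using K by (intro integral_cong_AE) auto
  finally show "complex_of_real (\<integral>z. ?D z \<partial>(T \<Otimes>\<^sub>M S)) = (\<integral>x. ?K x \<partial>(M \<Otimes>\<^sub>M M))" .
qed

text \<open>
  The numbers \<open>a\<close> and \<open>b\<close> are the squared \<open>L\<^sup>2\<close> norms of the two kernels: for \<open>cnj u\<close> in place of \<open>v\<close>,
  the second kernel is the conjugate of the first.
\<close>
lemma mixed_moment_Cauchy_Schwarz:
  fixes u :: "'t \<Rightarrow> 'w \<Rightarrow> complex" and v :: "'s \<Rightarrow> 'w \<Rightarrow> complex"
  assumes sf: "sigma_finite_measure M" "sigma_finite_measure T" "sigma_finite_measure S"
    and u: "case_prod u \<in> borel_measurable (T \<Otimes>\<^sub>M M)"
    and v: "case_prod v \<in> borel_measurable (S \<Otimes>\<^sub>M M)"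
    and ufin: "(\<integral>\<^sup>+t. \<integral>\<^sup>+w. ennreal ((cmod (u t w))\<^sup>2) \<partial>M \<partial>T) < \<infinity>"
    and vfin: "(\<integral>\<^sup>+s. \<integral>\<^sup>+w. ennreal ((cmod (v s w))\<^sup>2) \<partial>M \<partial>S) < \<infinity>"
  defines "a \<equiv> \<integral>(t, s). (cmod (\<integral>w. u t w * cnj (u s w) \<partial>M))\<^sup>2 \<partial>(T \<Otimes>\<^sub>M T)"
    and "b \<equiv> \<integral>(t, s). (cmod (\<integral>w. v t w * cnj (v s w) \<partial>M))\<^sup>2 \<partial>(S \<Otimes>\<^sub>M S)"
  assumes pos: "0 < a" "0 < b"
  shows "(\<integral>(t, s). (cmod (\<integral>w. u t w * v s w \<partial>M))\<^sup>2 \<partial>(T \<Otimes>\<^sub>M S)) \<le> sqrt (a * b)"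
proof -
  have kernel_square: "cov_kernel R f w w' * cov_kernel R (\<lambda>t w. cnj (f t w)) w w'
      = complex_of_real ((cmod (cov_kernel R f w w'))\<^sup>2)" for R :: "'x measure" and f w w'
  proof -
    have "cov_kernel R (\<lambda>t w. cnj (f t w)) w w' = cnj (cov_kernel R f w w')"
      unfolding cov_kernel_def by (subst Bochner_Integration.integral_cnj[symmetric]) simp
    then show ?thesis by (simp only: complex_norm_square)
  qed
  have square: "integrable (M \<Otimes>\<^sub>M M) (\<lambda>(w, w'). (cmod (cov_kernel R f w w'))\<^sup>2)"
      "(\<integral>(t, s). (cmod (\<integral>w. f t w * cnj (f s w) \<partial>M))\<^sup>2 \<partial>(R \<Otimes>\<^sub>M R))
        = (\<integral>(w, w'). (cmod (cov_kernel R f w w'))\<^sup>2 \<partial>(M \<Otimes>\<^sub>M M))"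
    if R: "sigma_finite_measure R" and f[measurable]: "case_prod f \<in> borel_measurable (R \<Otimes>\<^sub>M M)"
      and fin: "(\<integral>\<^sup>+t. \<integral>\<^sup>+w. ennreal ((cmod (f t w))\<^sup>2) \<partial>M \<partial>R) < \<infinity>"
    for R :: "'x measure" and f
  proof -
    have c: "case_prod (\<lambda>t w. cnj (f t w)) \<in> borel_measurable (R \<Otimes>\<^sub>M M)"
      using measurable_compose[OF f, of cnj borel]
      by (simp add: case_prod_beta' borel_measurable_continuous_onI continuous_on_cnj)
    note * = sf(1) R R f c fin
    show "integrable (M \<Otimes>\<^sub>M M) (\<lambda>(w, w'). (cmod (cov_kernel R f w w'))\<^sup>2)"
      using integrable_cov_kernel_mult[OF *] fin unfolding kernel_square
      by (simp add: case_prod_beta' complex_of_real_integrable_eq del: of_real_power)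
    show "(\<integral>(t, s). (cmod (\<integral>w. f t w * cnj (f s w) \<partial>M))\<^sup>2 \<partial>(R \<Otimes>\<^sub>M R))
        = (\<integral>(w, w'). (cmod (cov_kernel R f w w'))\<^sup>2 \<partial>(M \<Otimes>\<^sub>M M))"
      using integral_mixed_moment[OF *] fin unfolding kernel_square case_prod_beta' integral_complex_of_real
      by simp
  qed
  let ?D = "\<integral>(t, s). (cmod (\<integral>w. u t w * v s w \<partial>M))\<^sup>2 \<partial>(T \<Otimes>\<^sub>M S)"
  let ?K = "\<lambda>x. cov_kernel T u (fst x) (snd x)" and ?L = "\<lambda>x. cov_kernel S v (fst x) (snd x)"
  note mixed = sf u v ufin vfin
  have iKL: "integrable (M \<Otimes>\<^sub>M M) (\<lambda>x. ?K x * ?L x)"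
    using integrable_cov_kernel_mult[OF mixed] by (simp add: case_prod_beta')
  have iK: "integrable (M \<Otimes>\<^sub>M M) (\<lambda>x. (cmod (?K x))\<^sup>2)" and aK: "a = (\<integral>x. (cmod (?K x))\<^sup>2 \<partial>(M \<Otimes>\<^sub>M M))"
    using square[OF sf(2) u ufin] by (simp_all add: a_def case_prod_beta')
  have iL: "integrable (M \<Otimes>\<^sub>M M) (\<lambda>x. (cmod (?L x))\<^sup>2)" and bL: "b = (\<integral>x. (cmod (?L x))\<^sup>2 \<partial>(M \<Otimes>\<^sub>M M))"
    using square[OF sf(3) v vfin] by (simp_all add: b_def case_prod_beta')
  \<comment> \<open>The weight for which the arithmetic-geometric mean bound integrates to the geometric mean.\<close>
  define c where "c = sqrt (b / a)"
  have c: "c > 0" using pos by (simp add: c_def)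
  have "?D = Re (complex_of_real ?D)" by simp
  also have "\<dots> = Re (\<integral>x. ?K x * ?L x \<partial>(M \<Otimes>\<^sub>M M))"
    unfolding integral_mixed_moment[OF mixed] by (simp add: case_prod_beta')
  also have "\<dots> \<le> cmod (\<integral>x. ?K x * ?L x \<partial>(M \<Otimes>\<^sub>M M))" by (rule complex_Re_le_cmod)
  also have "\<dots> \<le> (\<integral>x. cmod (?K x * ?L x) \<partial>(M \<Otimes>\<^sub>M M))" by (rule integral_norm_bound)
  also have "\<dots> \<le> (\<integral>x. (c * (cmod (?K x))\<^sup>2 + (cmod (?L x))\<^sup>2 / c) / 2 \<partial>(M \<Otimes>\<^sub>M M))"
  proof (rule integral_mono)
    show "cmod (?K x * ?L x) \<le> (c * (cmod (?K x))\<^sup>2 + (cmod (?L x))\<^sup>2 / c) / 2" for x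
    proof -
      have "0 \<le> (c * cmod (?K x) - cmod (?L x))\<^sup>2 / (2 * c)" using c by simp
      also have "\<dots> = (c * (cmod (?K x))\<^sup>2 + (cmod (?L x))\<^sup>2 / c) / 2 - cmod (?K x) * cmod (?L x)"
        using c by (simp add: field_simps power2_eq_square)
      finally show ?thesis by (simp add: norm_mult)
    qed
  qed (use iKL iK iL in auto)
  also have "\<dots> = (c * a + b / c) / 2"
    using iK iL by (simp add: aK bL)
  also have "\<dots> = sqrt (a * b)"
  proof -
    have "c * a = sqrt (a * b)" "b / c = sqrt (a * b)"
      using pos by (simp_all add: c_def real_sqrt_divide real_sqrt_mult field_simps)
    then show ?thesis by simp
  qed
  finally show ?thesis .
qed

section \<open>Distance covariance and distance correlation\<close>

text \<open>
  The square root of the singular weight is absorbed into the process, so that all frequency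
  integrals are taken with respect to Lebesgue measure. At \<open>t = 0\<close> the value is \<open>0\<close> by division by
  zero, as for the integrand of the distance covariance.
\<close>
definition char_process ::
  "'w measure \<Rightarrow> ('w \<Rightarrow> 'a::euclidean_space) \<Rightarrow> 'a \<Rightarrow> 'w \<Rightarrow> complex" where
  "char_process M X t w =
    (iexp (t \<bullet> X w) - char_fun M X t) / complex_of_real (sqrt (norm t ^ (1 + DIM('a))))"

lemma char_process_measurable:
  assumes "prob_space M" and [measurable]: "X \<in> borel_measurable M"
  shows "case_prod (char_process M X) \<in> borel_measurable (lborel \<Otimes>\<^sub>M M)"
proof -
  have [measurable]: "char_fun M X \<in> borel_measurable borel"
    by (rule char_fun_measurable) fact+
  show ?thesis
    unfolding char_process_def case_prod_beta' by measurable
qed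

text \<open>
  The variance of \<open>Z = exp (i (t \<bullet> X))\<close> is at most its mean square distance from the constant \<open>1\<close>, and
  \<open>\<bar>Z - 1\<bar>\<^sup>2 = 2 * (1 - cos (t \<bullet> X))\<close>.
\<close>
lemma char_process_second_moment_le:
  fixes X :: "'w \<Rightarrow> 'a::euclidean_space"
  assumes "prob_space M" and [measurable]: "X \<in> borel_measurable M"
  shows "(\<integral>\<^sup>+w. ennreal ((cmod (char_process M X t w))\<^sup>2) \<partial>M)
    \<le> 2 * (\<integral>\<^sup>+w. ennreal ((1 - cos (t \<bullet> X w)) / norm t ^ (1 + DIM('a))) \<partial>M)"
proof -
  interpret prob_space M by fact
  define m where "m = char_fun M X t"
  define N where "N = norm t ^ (1 + DIM('a))"
  have N: "N \<ge> 0" by (simp add: N_def)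
  let ?Z = "\<lambda>w. iexp (t \<bullet> X w)"
  have iZ: "integrable M ?Z" by (rule integrable_const_bound[of _ 1]) auto
  have imZ: "integrable M (\<lambda>w. cnj m * ?Z w)" using iZ by simp
  have iC: "integrable M (\<lambda>w. cos (t \<bullet> X w))" by (rule integrable_const_bound[of _ 1]) auto
  have EZ: "(\<integral>w. ?Z w \<partial>M) = m" by (simp add: m_def char_fun_def)
  have sq: "(cmod (?Z w - m))\<^sup>2 = 1 - 2 * Re (cnj m * ?Z w) + (cmod m)\<^sup>2" for w
  proof -
    have "(cmod (z - m))\<^sup>2 = (cmod z)\<^sup>2 - 2 * Re (cnj m * z) + (cmod m)\<^sup>2" for z
      unfolding cmod_power2 by (simp add: power2_eq_square algebra_simps)
    then show ?thesis by simp
  qed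
  have iS: "integrable M (\<lambda>w. (cmod (?Z w - m))\<^sup>2)"
    unfolding sq
    by (intro Bochner_Integration.integrable_add Bochner_Integration.integrable_diff integrable_const
        integrable_mult_right integrable_Re imZ)
  have "(\<integral>w. (cmod (?Z w - m))\<^sup>2 \<partial>M) = 1 - 2 * Re (cnj m * m) + (cmod m)\<^sup>2"
    unfolding sq using integrable_Re[OF imZ] integral_Re[OF imZ] prob_space
    by (simp add: EZ del: times_complex.sel)
  also have "Re (cnj m * m) = (cmod m)\<^sup>2"
    unfolding cmod_power2 by (simp add: power2_eq_square)
  also have "1 - 2 * (cmod m)\<^sup>2 + (cmod m)\<^sup>2 \<le> 2 - 2 * Re m"
  proof -
    have "0 \<le> (1 - Re m)\<^sup>2 + (Im m)\<^sup>2" by simp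
    then show ?thesis unfolding cmod_power2 by (simp add: power2_eq_square algebra_simps)
  qed
  also have "2 - 2 * Re m = (\<integral>w. 2 * (1 - cos (t \<bullet> X w)) \<partial>M)"
  proof -
    have "Re m = (\<integral>w. cos (t \<bullet> X w) \<partial>M)"
      unfolding EZ[symmetric] integral_Re[OF iZ, symmetric] by (simp add: Re_exp)
    then show ?thesis using iC prob_space by simp
  qed
  finally have le: "(\<integral>w. (cmod (?Z w - m))\<^sup>2 \<partial>M) \<le> (\<integral>w. 2 * (1 - cos (t \<bullet> X w)) \<partial>M)" .
  have "(\<integral>\<^sup>+w. ennreal ((cmod (char_process M X t w))\<^sup>2) \<partial>M)
      = (\<integral>\<^sup>+w. ennreal ((cmod (?Z w - m))\<^sup>2 / N) \<partial>M)"
    using N by (simp add: char_process_def norm_divide power_divide m_def N_def)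
  also have "\<dots> = ennreal ((\<integral>w. (cmod (?Z w - m))\<^sup>2 \<partial>M) / N)"
    using iS N by (subst nn_integral_eq_integral) auto
  also have "\<dots> \<le> ennreal ((\<integral>w. 2 * (1 - cos (t \<bullet> X w)) \<partial>M) / N)"
    using le N by (intro ennreal_leI divide_right_mono)
  also have "\<dots> = (\<integral>\<^sup>+w. ennreal (2 * (1 - cos (t \<bullet> X w)) / N) \<partial>M)"
    using iC N by (subst nn_integral_eq_integral) auto
  also have "\<dots> = (\<integral>\<^sup>+w. 2 * ennreal ((1 - cos (t \<bullet> X w)) / N) \<partial>M)"
    by (intro nn_integral_cong, simp only: times_divide_eq_right[symmetric])
      (simp add: ennreal_mult' del: times_divide_eq_right)
  also have "\<dots> = 2 * (\<integral>\<^sup>+w. ennreal ((1 - cos (t \<bullet> X w)) / N) \<partial>M)"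
    by (rule nn_integral_cmult) measurable
  finally show ?thesis by (simp add: N_def)
qed

lemma char_process_square_integrable:
  fixes X :: "'w \<Rightarrow> 'a::euclidean_space"
  assumes M: "prob_space M" and X[measurable]: "X \<in> borel_measurable M"
    and int: "integrable M (\<lambda>w. norm (X w))"
  shows "(\<integral>\<^sup>+t. \<integral>\<^sup>+w. ennreal ((cmod (char_process M X t w))\<^sup>2) \<partial>M \<partial>lborel) < \<infinity>"
proof -
  interpret prob_space M by fact
  interpret pair_sigma_finite "lborel :: 'a measure" M ..
  obtain C where C: "0 \<le> C"
    "\<And>x :: 'a. (\<integral>\<^sup>+t. ennreal ((1 - cos (t \<bullet> x)) / norm t ^ (1 + DIM('a))) \<partial>lborel) \<le> ennreal (C * norm x)"
    using integral_one_minus_cos_bound[where 'a = 'a] by blast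
  have "(\<integral>\<^sup>+t. \<integral>\<^sup>+w. ennreal ((cmod (char_process M X t w))\<^sup>2) \<partial>M \<partial>lborel)
    \<le> (\<integral>\<^sup>+t. 2 * (\<integral>\<^sup>+w. ennreal ((1 - cos (t \<bullet> X w)) / norm t ^ (1 + DIM('a))) \<partial>M) \<partial>lborel)"
    by (intro nn_integral_mono char_process_second_moment_le M X)
  also have "\<dots> = 2 * (\<integral>\<^sup>+t. \<integral>\<^sup>+w. ennreal ((1 - cos (t \<bullet> X w)) / norm t ^ (1 + DIM('a))) \<partial>M \<partial>lborel)"
    by (rule nn_integral_cmult) measurable
  also have "\<dots> = 2 * (\<integral>\<^sup>+w. \<integral>\<^sup>+t. ennreal ((1 - cos (t \<bullet> X w)) / norm t ^ (1 + DIM('a))) \<partial>lborel \<partial>M)"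
    by (intro arg_cong[where f = "(*) 2"] Fubini'[symmetric]) measurable
  also have "\<dots> \<le> 2 * (\<integral>\<^sup>+w. ennreal (C * norm (X w)) \<partial>M)"
    by (intro mult_left_mono nn_integral_mono C(2)) simp
  also have "\<dots> < \<infinity>"
    using int C(1) by (subst nn_integral_eq_integral) (auto simp: ennreal_mult_less_top)
  finally show ?thesis .
qed

lemma char_process_mixed_moment:
  fixes X :: "'w \<Rightarrow> 'a::euclidean_space" and Y :: "'w \<Rightarrow> 'b::euclidean_space"
  assumes "prob_space M" and [measurable]: "X \<in> borel_measurable M" "Y \<in> borel_measurable M"
  shows "(cmod (\<integral>w. char_process M X t w * char_process M Y s w \<partial>M))\<^sup>2
    = (cmod (joint_char_fun M X Y t s - char_fun M X t * char_fun M Y s))\<^sup>2 /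
        (norm t ^ (1 + DIM('a)) * norm s ^ (1 + DIM('b)))"
proof -
  interpret prob_space M by fact
  let ?m = "char_fun M X t" and ?k = "char_fun M Y s"
  have i: "integrable M (\<lambda>w. iexp (t \<bullet> X w))" "integrable M (\<lambda>w. iexp (s \<bullet> Y w))"
    "integrable M (\<lambda>w. iexp (t \<bullet> X w) * iexp (s \<bullet> Y w))"
    by (rule integrable_const_bound[of _ 1]; simp add: norm_mult)+
  have "(\<integral>w. (iexp (t \<bullet> X w) - ?m) * (iexp (s \<bullet> Y w) - ?k) \<partial>M)
      = (\<integral>w. iexp (t \<bullet> X w) * iexp (s \<bullet> Y w) - iexp (t \<bullet> X w) * ?k - ?m * iexp (s \<bullet> Y w) + ?m * ?k \<partial>M)"
    by (intro Bochner_Integration.integral_cong refl) (simp add: algebra_simps)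
  also have "\<dots> = (\<integral>w. iexp (t \<bullet> X w) * iexp (s \<bullet> Y w) \<partial>M) - (\<integral>w. iexp (t \<bullet> X w) \<partial>M) * ?k
      - ?m * (\<integral>w. iexp (s \<bullet> Y w) \<partial>M) + ?m * ?k"
    using i prob_space by simp
  also have "\<dots> = joint_char_fun M X Y t s - ?m * ?k"
    by (simp add: joint_char_fun_def char_fun_def exp_add)
  finally have cov: "(\<integral>w. (iexp (t \<bullet> X w) - ?m) * (iexp (s \<bullet> Y w) - ?k) \<partial>M)
      = joint_char_fun M X Y t s - ?m * ?k" .
  show ?thesis
    unfolding char_process_def times_divide_times_eq integral_divide_zero cov
    by (simp add: norm_divide norm_mult power_divide power_mult_distrib)
qed

lemma char_process_uminus: "char_process M X (- t) w = cnj (char_process M X t w)"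
proof -
  have "char_fun M X (- t) = cnj (char_fun M X t)"
    unfolding char_fun_def
    by (subst Bochner_Integration.integral_cnj[symmetric]) (simp add: exp_cnj)
  then show ?thesis by (simp add: char_process_def exp_cnj)
qed

lemma lborel_integral_uminus:
  fixes f :: "'a::euclidean_space \<Rightarrow> real"
  assumes [measurable]: "f \<in> borel_measurable borel"
  shows "(\<integral>x. f (- x) \<partial>lborel) = (\<integral>x. f x \<partial>lborel)"
proof -
  have "distr lborel borel uminus = (lborel :: 'a measure)"
    using lborel_affine[of "-1" "0 :: 'a"] by (simp add: density_1)
  moreover have "(\<integral>x. f x \<partial>distr lborel borel uminus) = (\<integral>x. f (- x) \<partial>lborel)"
    by (rule integral_distr) auto
  ultimately show ?thesis by simp
qed

lemma dcov_const_pos: "0 < dcov_const d"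
  unfolding dcov_const_def by (intro divide_pos_pos Gamma_real_pos) auto

context
  fixes M :: "'w measure" and X :: "'w \<Rightarrow> 'a::euclidean_space"
  assumes M: "prob_space M" and X[measurable]: "X \<in> borel_measurable M"
    and intX: "integrable M (\<lambda>w. norm (X w))"
begin

lemma dcov2_char_process:
  fixes Y :: "'w \<Rightarrow> 'b::euclidean_space"
  assumes "Y \<in> borel_measurable M"
  shows "dcov2 M X Y = 1 / (dcov_const DIM('a) * dcov_const DIM('b)) *
    (\<integral>(t, s). (cmod (\<integral>w. char_process M X t w * char_process M Y s w \<partial>M))\<^sup>2 \<partial>(lborel \<Otimes>\<^sub>M lborel))"
  unfolding dcov2_def char_process_mixed_moment[OF M X assms] lborel_prod ..

lemma integrable_dcov2:
  fixes Y :: "'w \<Rightarrow> 'b::euclidean_space"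
  assumes Y: "Y \<in> borel_measurable M" and intY: "integrable M (\<lambda>w. norm (Y w))"
  shows "integrable (lborel \<Otimes>\<^sub>M lborel)
    (\<lambda>(t, s). (cmod (\<integral>w. char_process M X t w * char_process M Y s w \<partial>M))\<^sup>2)"
  by (intro integrable_mixed_moment char_process_measurable char_process_square_integrable
      sigma_finite_lborel prob_space_imp_sigma_finite M X intX Y intY)

text \<open>
  In the definition of the distance variance the process occurs twice without conjugation, while the
  kernel argument yields one conjugated factor. The reflection \<open>s \<mapsto> - s\<close> exchanges the two, since it
  conjugates the process and preserves Lebesgue measure.
\<close>
lemma dvar2_char_process:
  "dvar2 M X = 1 / (dcov_const DIM('a))\<^sup>2 *
    (\<integral>(t, s). (cmod (\<integral>w. char_process M X t w * cnj (char_process M X s w) \<partial>M))\<^sup>2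
      \<partial>(lborel \<Otimes>\<^sub>M lborel))"
proof -
  let ?F = "\<lambda>(t, s). (cmod (\<integral>w. char_process M X t w * char_process M X s w \<partial>M))\<^sup>2"
  let ?G = "\<lambda>(t, s). (cmod (\<integral>w. char_process M X t w * cnj (char_process M X s w) \<partial>M))\<^sup>2"
  note sf = prob_space_imp_sigma_finite[OF M]
  note pm = char_process_measurable[OF M X] and fin = char_process_square_integrable[OF M X intX]
  have "case_prod (\<lambda>t w. cnj (char_process M X t w)) \<in> borel_measurable (lborel \<Otimes>\<^sub>M M)"
    using measurable_compose[OF pm, of cnj borel]
    by (simp add: case_prod_beta' borel_measurable_continuous_onI continuous_on_cnj)
  then have iG: "integrable (lborel \<Otimes>\<^sub>M lborel) ?G"
    using fin by (intro integrable_mixed_moment sf sigma_finite_lborel pm) auto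
  have iF: "integrable (lborel \<Otimes>\<^sub>M lborel) ?F"
    by (rule integrable_dcov2[OF X intX])
  have "(\<integral>z. ?G z \<partial>(lborel \<Otimes>\<^sub>M lborel)) = (\<integral>t. \<integral>s. ?G (t, s) \<partial>lborel \<partial>lborel)"
    by (rule lborel_pair.integral_fst'[OF iG, symmetric])
  also have "\<dots> = (\<integral>t. \<integral>s. ?F (t, s) \<partial>lborel \<partial>lborel)"
  proof (rule Bochner_Integration.integral_cong[OF refl])
    fix t :: 'a
    have [measurable]: "?F \<in> borel_measurable (borel \<Otimes>\<^sub>M borel)"
      using borel_measurable_integrable[OF iF] by (simp cong: measurable_cong_sets)
    have "(\<lambda>s. ?F (t, s)) \<in> borel_measurable borel" by measurable
    from lborel_integral_uminus[OF this]
    show "(\<integral>s. ?G (t, s) \<partial>lborel) = (\<integral>s. ?F (t, s) \<partial>lborel)" by (simp add: char_process_uminus)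
  qed
  also have "\<dots> = (\<integral>z. ?F z \<partial>(lborel \<Otimes>\<^sub>M lborel))"
    by (rule lborel_pair.integral_fst'[OF iF])
  finally show ?thesis
    by (simp add: dvar2_def dcov2_char_process[OF X] power2_eq_square)
qed

end

lemma dcov2_nonneg: "0 \<le> dcov2 M X Y"
  unfolding dcov2_def
  by (intro mult_nonneg_nonneg Bochner_Integration.integral_nonneg)
    (auto intro!: divide_nonneg_nonneg mult_nonneg_nonneg simp: dcov_const_pos less_imp_le)

lemma dcov2_le_sqrt_dvar2:
  fixes X :: "'w \<Rightarrow> 'a::euclidean_space" and Y :: "'w \<Rightarrow> 'b::euclidean_space"
  assumes M: "prob_space M" and X: "X \<in> borel_measurable M" "integrable M (\<lambda>w. norm (X w))"
    and Y: "Y \<in> borel_measurable M" "integrable M (\<lambda>w. norm (Y w))"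
    and pos: "0 < dvar2 M X * dvar2 M Y"
  shows "dcov2 M X Y \<le> sqrt (dvar2 M X * dvar2 M Y)"
proof -
  let ?p = "dcov_const DIM('a)" and ?q = "dcov_const DIM('b)"
  let ?a = "\<integral>(t, s). (cmod (\<integral>w. char_process M X t w * cnj (char_process M X s w) \<partial>M))\<^sup>2
      \<partial>(lborel \<Otimes>\<^sub>M lborel)"
  let ?b = "\<integral>(t, s). (cmod (\<integral>w. char_process M Y t w * cnj (char_process M Y s w) \<partial>M))\<^sup>2
      \<partial>(lborel \<Otimes>\<^sub>M lborel)"
  let ?D = "\<integral>(t, s). (cmod (\<integral>w. char_process M X t w * char_process M Y s w \<partial>M))\<^sup>2
      \<partial>(lborel \<Otimes>\<^sub>M lborel)"
  note a = dvar2_char_process[OF M X] and b = dvar2_char_process[OF M Y]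
  have p: "?p > 0" "?q > 0" by (simp_all add: dcov_const_pos)
  have "dvar2 M X \<ge> 0" "dvar2 M Y \<ge> 0" by (simp_all add: dvar2_def dcov2_nonneg)
  with pos have "dvar2 M X > 0" "dvar2 M Y > 0" by (auto simp: zero_less_mult_iff)
  with p have "?a > 0" "?b > 0" unfolding a b by (simp_all add: zero_less_divide_iff)
  then have "?D \<le> sqrt (?a * ?b)"
    by (intro mixed_moment_Cauchy_Schwarz char_process_measurable char_process_square_integrable
        prob_space_imp_sigma_finite sigma_finite_lborel M X Y)
  then have "1 / (?p * ?q) * ?D \<le> 1 / (?p * ?q) * sqrt (?a * ?b)"
    using p by (intro mult_left_mono) auto
  also have "\<dots> = sqrt (dvar2 M X * dvar2 M Y)"
    unfolding a b using p by (simp add: real_sqrt_mult real_sqrt_divide)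
  finally show ?thesis unfolding dcov2_char_process[OF M X Y(1)] .
qed

text \<open>
  A continuous function that vanishes almost everywhere off the coordinate subspaces vanishes there
  everywhere; on the subspaces \<open>t = 0\<close> and \<open>s = 0\<close>, which the integrand ignores, the factorisation of
  the joint characteristic function is trivial.
\<close>
lemma dcov2_eq_0_iff_indep:
  fixes X :: "'w \<Rightarrow> 'a::euclidean_space" and Y :: "'w \<Rightarrow> 'b::euclidean_space"
  assumes M: "prob_space M" and X[measurable]: "X \<in> borel_measurable M" and iX: "integrable M (\<lambda>w. norm (X w))"
    and Y[measurable]: "Y \<in> borel_measurable M" and iY: "integrable M (\<lambda>w. norm (Y w))"
  shows "dcov2 M X Y = 0 \<longleftrightarrow> indep_rvec M X Y"
proof
  interpret prob_space M by fact
  assume 0: "dcov2 M X Y = 0"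
  let ?F = "\<lambda>(t, s). (cmod (\<integral>w. char_process M X t w * char_process M Y s w \<partial>M))\<^sup>2"
  define g where "g z = joint_char_fun M X Y (fst z) (snd z) - char_fun M X (fst z) * char_fun M Y (snd z)"
    for z :: "'a \<times> 'b"
  have F: "?F z = (cmod (g z))\<^sup>2 / (norm (fst z) ^ (1 + DIM('a)) * norm (snd z) ^ (1 + DIM('b)))" for z
    by (simp add: case_prod_beta' char_process_mixed_moment[OF M X Y] g_def)
  have "(\<integral>z. ?F z \<partial>(lborel \<Otimes>\<^sub>M lborel)) = 0"
    using 0 dcov_const_pos[of "DIM('a)"] dcov_const_pos[of "DIM('b)"]
    unfolding dcov2_char_process[OF M X iX Y] by simp
  moreover have "integrable (lborel \<Otimes>\<^sub>M lborel) ?F"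
    by (rule integrable_dcov2[OF M X iX Y iY])
  ultimately have "AE z in lborel \<Otimes>\<^sub>M lborel. ?F z = 0"
    by (subst (asm) integral_nonneg_eq_0_iff_AE) auto
  then have ae: "AE z in lborel. ?F z = 0" by (simp only: lborel_prod)
  have "continuous_on UNIV (char_fun M X)" "continuous_on UNIV (char_fun M Y)"
    "continuous_on UNIV (char_fun M (\<lambda>w. (X w, Y w)))"
    by (intro continuous_on_char_fun M; measurable)+
  then have cont: "continuous_on UNIV g"
    unfolding g_def joint_char_fun_eq_char_fun_pair
    by (auto intro!: continuous_intros continuous_on_compose2[of UNIV "char_fun M X"]
        continuous_on_compose2[of UNIV "char_fun M Y"])
  \<comment> \<open>Nonempty open sets have positive measure, so this one is empty.\<close>
  let ?O = "{z. g z \<noteq> 0} \<inter> {z. fst z \<noteq> 0} \<inter> {z. snd z \<noteq> 0}"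
  have "open ?O"
    by (intro open_Int open_Collect_neq cont continuous_intros)
  moreover have "AE z in lborel. z \<notin> ?O"
    using ae by eventually_elim (auto simp: F)
  ultimately have "?O = {}"
    using open_not_negligible[of ?O] AE_iff_null_sets[of ?O lborel] negligible_iff_null_sets[of ?O]
    by (auto simp: null_sets_completionI)
  then have nz: "g (t, s) = 0" if "t \<noteq> 0" "s \<noteq> 0" for t s
    using that by auto
  have one: "char_fun M X 0 = 1" "char_fun M Y 0 = 1"
    using prob_space by (simp_all add: char_fun_def)
  have "joint_char_fun M X Y t s = char_fun M X t * char_fun M Y s" for t s
  proof -
    consider "t = 0" | "s = 0" | "t \<noteq> 0" "s \<noteq> 0" by blast
    then show ?thesis
    proof cases
      case 1
      then show ?thesis by (simp add: one) (simp add: joint_char_fun_def char_fun_def)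
    next
      case 2
      then show ?thesis by (simp add: one) (simp add: joint_char_fun_def char_fun_def)
    next
      case 3
      then show ?thesis using nz[of t s] by (simp add: g_def)
    qed
  qed
  then show "indep_rvec M X Y" by (simp add: indep_rvec_iff_char_fun[OF M X Y])
next
  assume "indep_rvec M X Y"
  then show "dcov2 M X Y = 0"
    by (simp add: indep_rvec_iff_char_fun[OF M X Y] dcov2_def case_prod_beta')
qed

lemma indep_rvec_commute:
  assumes "prob_space M"
  shows "indep_rvec M X Y \<longleftrightarrow> indep_rvec M Y X"
proof -
  interpret prob_space M by fact
  have "indep_set B A" if "indep_set A B" for A B
  proof (rule indep_setI)
    show "prob (b \<inter> a) = prob b * prob a" if "b \<in> B" "a \<in> A" for a b
      using indep_setD[OF \<open>indep_set A B\<close> that(2,1)] by (simp add: Int_commute mult.commute)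
  qed (use that in \<open>auto dest: indep_setD_ev1 indep_setD_ev2\<close>)
  then show ?thesis unfolding indep_rvec_def by blast
qed

text \<open>
  Self-independence gives \<open>prob a = prob a * prob a\<close> for every event \<open>a\<close> of \<open>X\<close>, so these events have
  probability \<open>0\<close> or \<open>1\<close> and are independent of all others.
\<close>
lemma indep_rvec_self_imp_indep:
  assumes M: "prob_space M" and X[measurable]: "X \<in> borel_measurable M" and Y[measurable]: "Y \<in> borel_measurable M"
    and self: "indep_rvec M X X"
  shows "indep_rvec M X Y"
proof -
  interpret prob_space M by fact
  show ?thesis
    unfolding indep_rvec_def
  proof (rule indep_setI)
    fix a b
    assume a: "a \<in> {X -` A \<inter> space M |A. A \<in> sets borel}" and b: "b \<in> {Y -` B \<inter> space M |B. B \<in> sets borel}"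
    then have [measurable]: "a \<in> events" "b \<in> events" by auto
    have "prob (a \<inter> a) = prob a * prob a"
      using self unfolding indep_rvec_def by (rule indep_setD) (rule a)+
    then consider "prob a = 0" | "prob a = 1" by auto
    then show "prob (a \<inter> b) = prob a * prob b"
    proof cases
      case 1
      moreover have "prob (a \<inter> b) \<le> prob a" by (intro finite_measure_mono) auto
      ultimately show ?thesis using measure_nonneg[of M "a \<inter> b"] by simp
    next
      case 2
      then have "AE w in M. w \<in> a" by (simp add: prob_eq_1)
      then have "prob (a \<inter> b) = prob b"
        by (intro finite_measure_eq_AE) auto
      with 2 show ?thesis by simp
    qed
  qed auto
qed

text \<open>
  If one of the distance variances is \<open>0\<close>, the correlation is \<open>0\<close> by definition, and the corresponding
  vector is independent of itself, hence of the other one.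
\<close>
lemma dcor_bounds_and_independence:
  fixes X :: "'w \<Rightarrow> 'a::euclidean_space" and Y :: "'w \<Rightarrow> 'b::euclidean_space"
  assumes M: "prob_space M" and X: "X \<in> borel_measurable M" "integrable M (\<lambda>w. norm (X w))"
    and Y: "Y \<in> borel_measurable M" "integrable M (\<lambda>w. norm (Y w))"
  shows "0 \<le> dcor M X Y" "dcor M X Y \<le> 1" "dcor M X Y = 0 \<longleftrightarrow> indep_rvec M X Y"
proof -
  show "0 \<le> dcor M X Y" "dcor M X Y \<le> 1"
    using dcov2_nonneg[of M X Y] dcov2_le_sqrt_dvar2[OF M X Y]
    by (auto simp: dcor_def dcor2_def divide_le_eq)
  show "dcor M X Y = 0 \<longleftrightarrow> indep_rvec M X Y"
  proof (cases "dvar2 M X * dvar2 M Y > 0")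
    case True
    then show ?thesis
      using dcov2_eq_0_iff_indep[OF M X Y] by (auto simp: dcor_def dcor2_def)
  next
    case False
    have "dvar2 M X \<ge> 0" "dvar2 M Y \<ge> 0" by (simp_all add: dvar2_def dcov2_nonneg)
    with False have "dvar2 M X = 0 \<or> dvar2 M Y = 0" by (auto simp: zero_less_mult_iff)
    then have "indep_rvec M X X \<or> indep_rvec M Y Y"
      using dcov2_eq_0_iff_indep[OF M X X] dcov2_eq_0_iff_indep[OF M Y Y] by (simp add: dvar2_def)
    then have "indep_rvec M X Y"
      using indep_rvec_self_imp_indep[OF M X(1) Y(1)] indep_rvec_self_imp_indep[OF M Y(1) X(1)]
        indep_rvec_commute[OF M, of X Y] by blast
    with False show ?thesis by (simp add: dcor_def dcor2_def)
  qed
qed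

theorem theorem3:
  fixes M :: "'w measure" and N :: "'v measure"
    and X :: "'w \<Rightarrow> real^'p" and Y :: "'w \<Rightarrow> real^'q"
    and Xs :: "'n::finite \<Rightarrow> 'v \<Rightarrow> real^'p" and Ys :: "'n \<Rightarrow> 'v \<Rightarrow> real^'q"
  assumes "prob_space M"
    and "X \<in> borel_measurable M" and "Y \<in> borel_measurable M"
    and "prob_space N"
    and "prob_space.indep_vars N (\<lambda>_. borel) (\<lambda>k w. (Xs k w, Ys k w)) UNIV"
    and "\<And>k. distr N borel (\<lambda>w. (Xs k w, Ys k w)) = distr M borel (\<lambda>w. (X w, Y w))"
  shows
    "(integrable M (\<lambda>w. norm (X w) + norm (Y w)) \<longrightarrow>
        0 \<le> dcor M X Y \<and> dcor M X Y \<le> 1 \<and>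
        (dcor M X Y = 0 \<longleftrightarrow> indep_rvec M X Y)) \<and>
     (\<forall>w\<in>space N.
        0 \<le> emp_dcor (sample_matrix Xs w) (sample_matrix Ys w) \<and>
        emp_dcor (sample_matrix Xs w) (sample_matrix Ys w) \<le> 1) \<and>
     (\<forall>w\<in>space N.
        emp_dcor (sample_matrix Xs w) (sample_matrix Ys w) = 1 \<longrightarrow>
        (\<exists>(a :: real^'q) (b :: real) (C :: real^'q^'p).
           b \<noteq> 0 \<and> orthogonal_rect C \<and>
           sample_matrix Ys w = (\<chi> k. a) + b *\<^sub>R (sample_matrix Xs w ** C)))"
proof (intro conjI impI ballI)
  assume "integrable M (\<lambda>w. norm (X w) + norm (Y w))"
  then have "integrable M (\<lambda>w. norm (X w))" "integrable M (\<lambda>w. norm (Y w))"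
    using assms(2,3) by (auto intro: Bochner_Integration.integrable_bound)
  note * = dcor_bounds_and_independence[OF assms(1,2) this(1) assms(3) this(2)]
  show "0 \<le> dcor M X Y" "dcor M X Y \<le> 1" by (rule *)+
  show "dcor M X Y = 0 \<longleftrightarrow> indep_rvec M X Y" by (rule *)
next
  fix w
  show "0 \<le> emp_dcor (sample_matrix Xs w) (sample_matrix Ys w)"
    "emp_dcor (sample_matrix Xs w) (sample_matrix Ys w) \<le> 1"
    by (rule emp_dcor_bounds)+
next
  fix w
  assume "emp_dcor (sample_matrix Xs w) (sample_matrix Ys w) = 1"
  then show "\<exists>(a :: real^'q) (b :: real) (C :: real^'q^'p).
      b \<noteq> 0 \<and> orthogonal_rect C \<and>
      sample_matrix Ys w = (\<chi> k. a) + b *\<^sub>R (sample_matrix Xs w ** C)"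
    by (rule emp_dcor_eq_1_imp_similar)
qed

end
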